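(* For any $\varepsilon > 0$ there exists $N \in \mathbb{N}$ such that whenever $n > N$ and $A, B, C, D$ are normal subsets of $G = \mathrm{Alt}(n)$ such that all of the numbers $|A||B|$, $|A||C|$, $|A||D|$, $|B||C|$, $|B||D|$, $|C||D|$ are at least $|G|^{1+\varepsilon}$, then $ABCD = G$.
   Context: $\mathrm{Alt}(n)$ denotes the alternating group on $n$ letters. A subset $A$ of a group $G$ is called normal if $gAg^{-1} = A$ for all $g \in G$ (equivalently, $A$ is a union of conjugacy classes of $G$). For subsets $A, B$ of $G$, $AB$ denotes the set of products $ab$ with $a \in A$, $b \in B$; similarly $ABCD = \{abcd : a \in A, b \in B, c \in C, d \in D\}$. *)

theory Defs
  imports Complex_Main "HOL-Algebra.Sym_Groups"
begin

definition normal_subset :: "'a set \<Rightarrow> ('a, 'b) monoid_scheme \<Rightarrow> bool" where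
  "normal_subset A G \<longleftrightarrow>
     A \<subseteq> carrier G \<and> (\<forall>g\<in>carrier G. g <#\<^bsub>G\<^esub> A #>\<^bsub>G\<^esub> (inv\<^bsub>G\<^esub> g) = A)"

end

theory Submission
  imports Defs "HOL-Combinatorics.Orbits" "HOL-Library.Multiset" "HOL-Real_Asymp.Real_Asymp"
begin

text \<open>
  The proof is combinatorial. Let c(a) be the number of cycles of a permutation a of n points, with
  fixed points counted as cycles. For each j, at most 2^n n^j permutations have at least n - j
  cycles, whereas n! is n^n up to a factor that is exponential in n. So if n is large and
  |A| |B| is at least |G|^(1 + \<epsilon>), then A and B contain elements a and b with
  c(a) + c(b) + 10 \<le> n (lemma few_orbs_if_large). The same holds for C and D.

  Let k be 2 for odd n and 3 for even n, and let T be the set of all permutations that consist of a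
  cycle of length n - k and k fixed points. These permutations are even, and they form one conjugacy
  class of G, since the transposition of two fixed points of an element of T is odd and commutes with
  it. It suffices to prove that T is contained in AB and in CD, and that TT = G.

  The main step is exists_conj_one_cycle: if c(a) + c(b) < n and the signs allow it, then a and a
  suitable conjugate of b multiply to an n-cycle. Its proof takes the conjugate for which the product
  has the least number of cycles and shows that conjugating by transpositions could lower this number
  if it were at least 3; the sign then excludes 2. To obtain elements of T instead of n-cycles, a
  pair of permutations is viewed as a bipartite map on a surface, whose edges are the points, whose
  vertices are the cycles of a and b, and whose faces are the cycles of a b. Some edges are deleted,
  the main step is applied to the rest, and the edges are put back so that just k of them cut off a
  small face next to a parallel edge. These faces are the fixed points of the product (lemma
  realizable_if_large).

  This yields a conjugate of b in the symmetric group. An even conjugator can be chosen at once if an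
  odd permutation commutes with a or with b. Otherwise the cycles of each of a and b have different
  lengths, so both have a long cycle, and two 5-cycles can be inserted there in two ways that differ
  by an odd conjugator (lemma flip_products). Hence AB meets T and contains it (lemma
  hook_subset_product).

  Finally, TT = G follows from the same results, applied to an element g of G and a long
  cycle: some conjugates of them multiply to an element of T (lemma even_perm_product_of_hooks).
\<close>

section \<open>Cycles and multiplication by a transposition\<close>

abbreviation tr :: "'a \<Rightarrow> 'a \<Rightarrow> 'a \<Rightarrow> 'a" where
  "tr \<equiv> Transposition.transpose"

text \<open>
  Cycles are represented by their sets of points, and fixed points count as cycles.
\<close>

definition orbs :: "'a set \<Rightarrow> ('a \<Rightarrow> 'a) \<Rightarrow> 'a set set" where
  "orbs S f = orbit f ` S"

lemma permutation_if_permutes: "f permutes S \<Longrightarrow> finite S \<Longrightarrow> permutation f"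
  by (auto simp: permutation_permutes)

lemma self_in_orbit: "f permutes S \<Longrightarrow> finite S \<Longrightarrow> x \<in> orbit f x"
  by (simp add: permutation_if_permutes permutation_self_in_orbit)

lemma orbit_eq_if_mem:
  assumes "f permutes S" "finite S" "y \<in> orbit f x" shows "orbit f y = orbit f x"
  using orbit_cyclic_eq3[OF cyclic_on_orbit[OF assms(1,2)] assms(3)] .

lemma orbit_mem_sym:
  assumes "f permutes S" "finite S" "y \<in> orbit f x" shows "x \<in> orbit f y"
  using orbit_eq_if_mem[OF assms] self_in_orbit[OF assms(1,2)] by blast

lemma orbit_subset_closed:
  assumes "z \<in> Z" "\<And>w. w \<in> Z \<Longrightarrow> f w \<in> Z" shows "orbit f z \<subseteq> Z"
proof
  fix y assume "y \<in> orbit f z"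
  then show "y \<in> Z" by induction (use assms in auto)
qed

lemma orbit_fixpoint: "f x = x \<Longrightarrow> orbit f x = {x}"
  by (simp add: orbit_eq_singleton_iff)

lemma card_orbit_eq_1_iff:
  assumes "f permutes S" "finite S" shows "card (orbit f x) = 1 \<longleftrightarrow> f x = x"
proof
  assume "card (orbit f x) = 1"
  then obtain y where "orbit f x = {y}" by (rule card_1_singletonE)
  then show "f x = x" using self_in_orbit[OF assms, of x] orbit_eq_singleton_iff[of f x] by simp
qed (simp add: orbit_fixpoint)

lemma orbit_subset_carrier: "f permutes S \<Longrightarrow> x \<in> S \<Longrightarrow> orbit f x \<subseteq> S"
  by (rule permutes_orbit_subset)

lemma finite_orbs[simp]: "finite S \<Longrightarrow> finite (orbs S f)"
  by (simp add: orbs_def)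

lemma orbs_inv: "f permutes S \<Longrightarrow> finite S \<Longrightarrow> orbs S (inv' f) = orbs S f"
  by (simp add: orbs_def orbit_inv_eq permutation_if_permutes)

lemma orbit_f: "f permutes S \<Longrightarrow> finite S \<Longrightarrow> orbit f (f x) = orbit f x"
  by (simp add: permutation_if_permutes permutation_orbit_step)

lemma tr_tr_comp: "(f \<circ> tr x y) \<circ> tr x y = f"
  by (simp add: fun_eq_iff)

lemma permutes_comp_tr:
  assumes "f permutes S" "x \<in> S" "y \<in> S" shows "f \<circ> tr x y permutes S"
  using permutes_compose[OF permutes_swap_id[OF assms(2,3)] assms(1)] .

text \<open>
  From f y, which is the image of x under the product, f runs through the orbit of y without
  meeting x. So the orbit of x under the product contains y, hence both old orbits.
\<close>

lemma orbit_merge: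
  assumes f: "f permutes S" "finite S" "x \<in> S" "y \<in> S" and xy: "y \<notin> orbit f x"
  shows "orbit (f \<circ> tr x y) z =
    (if z \<in> orbit f x \<union> orbit f y then orbit f x \<union> orbit f y else orbit f z)"
proof -
  define g where "g = f \<circ> tr x y"
  have g: "g permutes S" unfolding g_def by (rule permutes_comp_tr[OF f(1,3,4)])
  note [simp] = self_in_orbit[OF f(1,2)] self_in_orbit[OF g f(2)]
  have yx: "x \<notin> orbit f y" using xy orbit_mem_sym[OF f(1,2), of x y] by blast
  have gx: "g x = f y" and gy: "g y = f x" and gz: "\<And>z. z \<noteq> x \<Longrightarrow> z \<noteq> y \<Longrightarrow> g z = f z"
    by (auto simp: g_def)
  let ?W = "orbit f x \<union> orbit f y"
  have W_closed: "g w \<in> ?W" if "w \<in> ?W" for w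
    using that gx gy gz[of w] orbit.base[of f x] orbit.base[of f y]
      orbit.step[of w f x] orbit.step[of w f y]
    by (cases "w = x"; cases "w = y") auto
  \<comment> \<open>Otherwise g and f agree on the points of the f-orbit of y that lie in the g-orbit of x, so
    these points form an f-closed set; it contains f y, hence y.\<close>
  have "y \<in> orbit g x"
  proof (rule ccontr)
    assume ny: "y \<notin> orbit g x"
    let ?Z = "orbit g x \<inter> orbit f y"
    have "f y \<in> orbit g x" using gx orbit.base[of g x] by simp
    then have "f y \<in> ?Z" using orbit.base[of f y] by simp
    moreover have "f w \<in> ?Z" if "w \<in> ?Z" for w
    proof -
      have "w \<noteq> x" "w \<noteq> y" using that yx ny by auto
      then have "f w = g w" using gz by simp
      then show ?thesis using that orbit.step[of w g x] orbit.step[of w f y] by simp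
    qed
    ultimately have "orbit f (f y) \<subseteq> ?Z" by (rule orbit_subset_closed)
    then show False using ny orbit_f[OF f(1,2), of y] self_in_orbit[OF f(1,2), of y] by blast
  qed
  then have yx': "orbit g y = orbit g x" by (rule orbit_eq_if_mem[OF g f(2)])
  have closed: "f w \<in> orbit g x" if "w \<in> orbit g x" for w
  proof (cases "w = x \<or> w = y")
    case True
    then show ?thesis using gx gy yx' orbit.base[of g x] orbit.base[of g y] by auto
  next
    case False
    then show ?thesis using gz[of w] that by (metis orbit.step)
  qed
  have "orbit f x \<subseteq> orbit g x" by (rule orbit_subset_closed) (auto intro: closed)
  moreover have "orbit f y \<subseteq> orbit g x"
    by (rule orbit_subset_closed) (use \<open>y \<in> orbit g x\<close> in \<open>auto intro: closed\<close>)
  moreover have "orbit g x \<subseteq> ?W"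
  proof (rule orbit_subset_closed)
    show "g w \<in> ?W" if "w \<in> ?W" for w using that by (rule W_closed)
  qed simp
  ultimately have W: "orbit g x = ?W" by blast
  show ?thesis
  proof (cases "z \<in> ?W")
    case True
    then show ?thesis using orbit_eq_if_mem[OF g f(2), of z x] W unfolding g_def by simp
  next
    case False
    have "orbit g z = orbit f z"
    proof (rule orbit_cong)
      fix s assume "s \<in> orbit f z"
      then have "z \<in> orbit f s" by (rule orbit_mem_sym[OF f(1,2)])
      then have "s \<noteq> x" "s \<noteq> y" using False by auto
      then show "g s = f s" by (rule gz)
    qed simp
    then show ?thesis using False by (simp add: g_def)
  qed
qed

lemma orbs_merge:
  assumes f: "f permutes S" "finite S" "x \<in> S" "y \<in> S" and xy: "y \<notin> orbit f x"
  shows "orbs S (f \<circ> tr x y) =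
    insert (orbit f x \<union> orbit f y) (orbs S f - {orbit f x, orbit f y})" (is "?L = ?R")
proof
  have mem: "z \<in> orbit f w \<longleftrightarrow> orbit f z = orbit f w" for z w
    using orbit_eq_if_mem[OF f(1,2)] self_in_orbit[OF f(1,2)] by metis
  note merge = orbit_merge[OF assms]
  show "?L \<subseteq> ?R"
  proof
    fix U assume "U \<in> ?L"
    then obtain z where z: "z \<in> S" "U = orbit (f \<circ> tr x y) z" unfolding orbs_def by blast
    show "U \<in> ?R"
    proof (cases "z \<in> orbit f x \<union> orbit f y")
      case True
      then have "U = orbit f x \<union> orbit f y" unfolding z(2) merge[of z] by (rule if_P)
      then show ?thesis by blast
    next
      case False
      then have "orbit f z \<noteq> orbit f x" "orbit f z \<noteq> orbit f y" using mem[of z] by blast+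
      moreover have "U = orbit f z" unfolding z(2) merge[of z] using False by (rule if_not_P)
      ultimately show ?thesis using z(1) unfolding orbs_def by blast
    qed
  qed
  show "?R \<subseteq> ?L"
  proof
    fix U assume "U \<in> ?R"
    then consider "U = orbit f x \<union> orbit f y"
      | z where "z \<in> S" "U = orbit f z" "U \<noteq> orbit f x" "U \<noteq> orbit f y"
      unfolding orbs_def by blast
    then show "U \<in> ?L"
    proof cases
      case 1
      then have "U = orbit (f \<circ> tr x y) x" using merge[of x] self_in_orbit[OF f(1,2)] by simp
      then show ?thesis using f(3) unfolding orbs_def by blast
    next
      case 2
      then have "z \<notin> orbit f x \<union> orbit f y" using mem[of z] by blast
      then have "orbit (f \<circ> tr x y) z = U" unfolding merge[of z] 2(2) by (rule if_not_P)
      then show ?thesis using 2(1) unfolding orbs_def by blast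
    qed
  qed
qed

lemma card_orbs_merge:
  assumes f: "f permutes S" "finite S" "x \<in> S" "y \<in> S" and xy: "y \<notin> orbit f x"
  shows "Suc (card (orbs S (f \<circ> tr x y))) = card (orbs S f)"
proof -
  note [simp] = self_in_orbit[OF f(1,2)]
  have neq: "orbit f x \<noteq> orbit f y" using xy self_in_orbit[OF f(1,2), of y] by metis
  have "orbit f x \<union> orbit f y \<notin> orbs S f - {orbit f x, orbit f y}"
  proof
    assume "orbit f x \<union> orbit f y \<in> orbs S f - {orbit f x, orbit f y}"
    then obtain z where z: "orbit f z = orbit f x \<union> orbit f y" unfolding orbs_def by blast
    have "x \<in> orbit f z" "y \<in> orbit f z" unfolding z by simp_all
    then show False using neq orbit_eq_if_mem[OF f(1,2)] by metis
  qed
  moreover have "card (orbs S f - {orbit f x, orbit f y}) = card (orbs S f) - 2"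
    using neq f by (subst card_Diff_subset) (auto simp: orbs_def)
  moreover have "card {orbit f x, orbit f y} \<le> card (orbs S f)"
    using f by (intro card_mono) (auto simp: orbs_def)
  ultimately show ?thesis unfolding orbs_merge[OF assms] using neq f(2) by simp
qed

text \<open>
  Composing f with the transposition of a point p and a new point x inserts x right after p into
  the cycle of p. Every permutation that moves x arises in this way (remove_point below), which
  makes induction on the number of points possible.
\<close>

lemma orbs_insert_fixed:
  assumes "f permutes S" "x \<notin> S"
  shows "orbs (insert x S) f = insert {x} (orbs S f)"
  using assms by (simp add: orbs_def orbit_fixpoint permutes_not_in)

lemma permutes_insert_point:
  assumes "f permutes S" "p \<in> S" shows "f \<circ> tr p x permutes insert x S"
  by (rule permutes_comp_tr) (use assms in \<open>auto intro: permutes_subset\<close>)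

lemma
  assumes f: "f permutes S" "finite S" "x \<notin> S" "p \<in> S"
  shows orbit_insert_point: "orbit (f \<circ> tr p x) z =
      (if z \<in> insert x (orbit f p) then insert x (orbit f p) else orbit f z)"
    and orbs_insert_point: "orbs (insert x S) (f \<circ> tr p x) =
      insert (insert x (orbit f p)) (orbs S f - {orbit f p})"
proof -
  have x: "orbit f x = {x}" using f by (simp add: orbit_fixpoint permutes_not_in)
  have f': "f permutes insert x S" by (rule permutes_subset[OF f(1)]) auto
  have nx: "x \<notin> orbit f p" using orbit_subset_carrier[OF f(1,4)] f(3) by blast
  have xn: "{x} \<notin> orbs S f" using orbit_subset_carrier[OF f(1)] f(3) by (force simp: orbs_def)
  have un: "orbit f p \<union> {x} = insert x (orbit f p)" by auto
  show "orbit (f \<circ> tr p x) z =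
      (if z \<in> insert x (orbit f p) then insert x (orbit f p) else orbit f z)"
    using orbit_merge[OF f' _ _ _ nx, of z] f x un by simp
  show "orbs (insert x S) (f \<circ> tr p x) = insert (insert x (orbit f p)) (orbs S f - {orbit f p})"
  proof -
    have "orbs (insert x S) (f \<circ> tr p x) =
      insert (orbit f p \<union> {x}) (insert {x} (orbs S f) - {orbit f p, {x}})"
      using orbs_merge[OF f' _ _ _ nx] f x orbs_insert_fixed[OF f(1,3)] by simp
    also have "insert {x} (orbs S f) - {orbit f p, {x}} = orbs S f - {orbit f p}"
      using xn by blast
    finally show ?thesis unfolding un .
  qed
qed

lemma permutes_if_fixed:
  assumes f: "f permutes insert x S" and "f x = x" shows "f permutes S"
  by (rule permutes_superset[OF f]) (use assms in auto)

lemma remove_point: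
  assumes f: "f permutes insert x S" and x: "x \<notin> S" "f x \<noteq> x"
  obtains g p where "g permutes S" "p \<in> S" "f = g \<circ> tr p x" "f p = x"
proof -
  define p where "p = inv' f x"
  have fp: "f p = x" using f by (simp add: permutes_inverses p_def)
  have p: "p \<in> S" using f x fp permutes_in_image[OF f, of p] by auto
  let ?g = "f \<circ> tr p x"
  have "?g permutes insert x S" using f p by (intro permutes_comp_tr) auto
  then have "?g permutes S" by (rule permutes_if_fixed) (use fp in simp)
  moreover have "f = ?g \<circ> tr p x" by (simp add: tr_tr_comp)
  ultimately show ?thesis using p fp by (intro that[of ?g p])
qed

lemma card_orbs_insert_point:
  assumes f: "f permutes S" "finite S" "x \<notin> S" "p \<in> S"
  shows "card (orbs (insert x S) (f \<circ> tr p x)) = card (orbs S f)"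
proof -
  have "insert x (orbit f p) \<notin> orbs S f"
    using orbit_subset_carrier[OF f(1)] f(3) by (force simp: orbs_def)
  moreover have "orbit f p \<in> orbs S f" using f by (auto simp: orbs_def)
  moreover have "card (orbs S f) > 0" using calculation(2) f(2) by (auto simp: card_gt_0_iff)
  ultimately show ?thesis unfolding orbs_insert_point[OF f] using f(2)
    by (simp add: card_Diff_singleton)
qed

lemma card_orbit_insert_point:
  assumes f: "f permutes S" "finite S" "x \<notin> S" "p \<in> S" and z: "z \<in> insert x (orbit f p)"
  shows "card (orbit (f \<circ> tr p x) z) = Suc (card (orbit f p))"
  using orbit_insert_point[OF f, of z] z orbit_subset_carrier[OF f(1,4)] f(3)
    finite_subset[OF orbit_subset_carrier[OF f(1,4)] f(2)] by (auto simp: card_insert_if)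

lemma card_orbs_insert_fixed:
  assumes "f permutes S" "finite S" "x \<notin> S"
  shows "card (orbs (insert x S) f) = Suc (card (orbs S f))"
proof -
  have "{x} \<notin> orbs S f" using orbit_subset_carrier[OF assms(1)] assms(3) by (force simp: orbs_def)
  then show ?thesis using assms by (simp add: orbs_insert_fixed)
qed

lemma evenperm_comp_tr:
  assumes "f permutes S" "finite S" "x \<noteq> y" shows "evenperm (f \<circ> tr x y) \<longleftrightarrow> \<not> evenperm f"
  using assms by (simp add: evenperm_comp permutation_if_permutes permutation_swap_id evenperm_swap)

lemma evenperm_iff_orbs:
  assumes "finite S" "f permutes S"
  shows "evenperm f \<longleftrightarrow> even (card S + card (orbs S f))"
  using assms
proof (induction S arbitrary: f rule: finite_induct)
  case empty
  then show ?case by (simp add: orbs_def)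
next
  case (insert x S)
  show ?case
  proof (cases "f x = x")
    case True
    with insert.prems have "f permutes S" by (rule permutes_if_fixed)
    then show ?thesis using insert.IH[of f] insert.hyps by (simp add: card_orbs_insert_fixed)
  next
    case False
    obtain g p where g: "g permutes S" "p \<in> S" and f: "f = g \<circ> tr p x"
      using remove_point[OF insert.prems insert.hyps(2) False] .
    have "p \<noteq> x" using g(2) insert.hyps by auto
    then have "evenperm f \<longleftrightarrow> \<not> evenperm g"
      unfolding f by (rule evenperm_comp_tr[OF g(1) insert.hyps(1)])
    moreover have "card (orbs (insert x S) f) = card (orbs S g)"
      unfolding f by (rule card_orbs_insert_point[OF g(1) insert.hyps g(2)])
    ultimately show ?thesis using insert.IH[OF g(1)] insert.hyps by simp
  qed
qed

text \<open>
  If x and y were in one orbit both before and after the multiplication, then the orbits would not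
  change at all, although the sign does.
\<close>

lemma orbit_split:
  assumes f: "f permutes S" "finite S" "x \<in> S" "y \<in> S" and xy: "x \<noteq> y" "y \<in> orbit f x"
  shows "y \<notin> orbit (f \<circ> tr x y) x"
proof
  assume y: "y \<in> orbit (f \<circ> tr x y) x"
  define g where "g = f \<circ> tr x y"
  have g: "g permutes S" unfolding g_def by (rule permutes_comp_tr[OF f(1,3,4)])
  have sub: "orbit h' z \<subseteq> orbit h z"
    if h: "h permutes S" "h' permutes S" "h' = h \<circ> tr x y" "y \<in> orbit h x" for h h' z
  proof (rule orbit_subset_closed)
    show "z \<in> orbit h z" by (rule self_in_orbit[OF h(1) f(2)])
    fix w assume w: "w \<in> orbit h z"
    have eq: "orbit h y = orbit h x" using orbit_eq_if_mem[OF h(1) f(2) h(4)] .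
    have "orbit h (h' w) = orbit h w"
      using eq orbit_f[OF h(1) f(2)] h(3) by (auto simp: Transposition.transpose_def)
    also have "\<dots> = orbit h z" using orbit_eq_if_mem[OF h(1) f(2) w] .
    finally show "h' w \<in> orbit h z" using self_in_orbit[OF h(1) f(2)] by metis
  qed
  have "orbit g z = orbit f z" for z
    using sub[OF f(1) g _ xy(2)] sub[OF g f(1)] y unfolding g_def by (auto simp: tr_tr_comp)
  then have "orbs S g = orbs S f" by (simp add: orbs_def)
  then have "evenperm f = evenperm g" using evenperm_iff_orbs[OF f(2,1)] evenperm_iff_orbs[OF f(2) g] by simp
  then show False using evenperm_comp_tr[OF f(1,2) xy(1)] g_def by simp
qed

lemma card_orbs_comp_tr_le:
  assumes f: "f permutes S" "finite S" "x \<in> S" "y \<in> S"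
  shows "card (orbs S (f \<circ> tr x y)) \<le> Suc (card (orbs S f))"
proof (cases "x = y \<or> y \<notin> orbit f x")
  case True
  then show ?thesis using card_orbs_merge[OF f] by auto
next
  case False
  then have "y \<notin> orbit (f \<circ> tr x y) x" by (intro orbit_split[OF f]) auto
  from card_orbs_merge[OF permutes_comp_tr[OF f(1,3,4)] f(2-4) this]
  show ?thesis by (simp add: tr_tr_comp)
qed

section \<open>Conjugating one factor to make the product a single cycle\<close>

lemma orbs_disjoint:
  assumes "f permutes S" "finite S" "V \<in> orbs S f" "W \<in> orbs S f" "V \<noteq> W"
  shows "V \<inter> W = {}"
proof (rule ccontr)
  assume "V \<inter> W \<noteq> {}"
  then obtain z where z: "z \<in> V" "z \<in> W" by blast
  obtain v w where "V = orbit f v" "W = orbit f w" using assms(3,4) unfolding orbs_def by blast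
  then have "orbit f z = V" "orbit f z = W"
    using z orbit_eq_if_mem[OF assms(1,2), of z v] orbit_eq_if_mem[OF assms(1,2), of z w] by auto
  then show False using assms(5) by simp
qed

lemma Union_orbs_closed:
  assumes f: "f permutes S" "finite S" "\<And>w. w \<in> X \<Longrightarrow> f w \<in> X" shows "\<Union>(orbs X f) = X"
proof
  show "\<Union>(orbs X f) \<subseteq> X" unfolding orbs_def using orbit_subset_closed[of _ X f] f(3) by blast
  show "X \<subseteq> \<Union>(orbs X f)" unfolding orbs_def using self_in_orbit[OF f(1,2)] by blast
qed

lemma orbs_conj:
  assumes b: "b permutes S" and h: "h permutes S" and S: "finite S"
  shows "orbs S (h \<circ> b \<circ> inv' h) = (\<lambda>V. h ` V) ` orbs S b"
proof -
  have "h ` orbit b z = orbit (h \<circ> b \<circ> inv' h) (h z)" for z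
    by (rule orbit_inverse) (use self_in_orbit[OF b S] permutes_inverses(2)[OF h] in simp_all)
  then have "(\<lambda>V. h ` V) ` orbs S b = orbit (h \<circ> b \<circ> inv' h) ` (h ` S)"
    unfolding orbs_def image_image by simp
  then show ?thesis unfolding orbs_def permutes_image[OF h] by simp
qed

lemma card_orbs_conj:
  assumes b: "b permutes S" and h: "h permutes S" and S: "finite S"
  shows "card (orbs S (h \<circ> b \<circ> inv' h)) = card (orbs S b)"
  unfolding orbs_conj[OF assms]
  by (intro card_image inj_onI) (simp add: inj_image_eq_iff[OF permutes_inj[OF h]])

lemma permutes_conj:
  assumes "b permutes S" "h permutes S" shows "h \<circ> b \<circ> inv' h permutes S"
  by (intro permutes_compose permutes_inv assms)

lemma inv_tr[simp]: "inv' (tr x y) = tr x y"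
  by (simp add: inv_unique_comp fun_eq_iff)

text \<open>
  Conjugating b by the transposition of b p and b q multiplies a b on the right by two
  transpositions. All moves below are of this form.
\<close>

lemma comp_conj_tr:
  assumes "b permutes S"
  shows "a \<circ> (tr (b p) (b q) \<circ> b \<circ> tr (b p) (b q)) = (a \<circ> b) \<circ> tr p q \<circ> tr (b p) (b q)"
proof -
  have "tr (b p) (b q) (b z) = b (tr p q z)" for z
    using injD[OF permutes_inj[OF assms]] by (auto simp: Transposition.transpose_def)
  then show ?thesis by (simp add: fun_eq_iff)
qed

text \<open>
  Pigeonhole: assign to a subset of S the set of those orbits of a and of b that it meets in an odd
  number of points. By the inequality there are fewer values than subsets. The symmetric difference
  of two subsets with equal values meets every orbit, and so every invariant set, in an even number
  of points.
  In the bipartite graph whose edges are the points and whose vertices are the cycles of a and b,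
  such a set is a nonzero element of the cycle space over the field with two elements.
\<close>

lemma parity_set:
  assumes a: "a permutes S" and b: "b permutes S" and S: "finite S"
    and less: "card (orbs S a) + card (orbs S b) < card S"
  obtains D where "D \<subseteq> S" "D \<noteq> {}"
    "\<And>X. X \<subseteq> S \<Longrightarrow> (\<And>w. w \<in> X \<Longrightarrow> a w \<in> X) \<Longrightarrow> even (card (D \<inter> X))"
    "\<And>X. X \<subseteq> S \<Longrightarrow> (\<And>w. w \<in> X \<Longrightarrow> b w \<in> X) \<Longrightarrow> even (card (D \<inter> X))"
proof -
  define odds where "odds f D = {V \<in> orbs S f. odd (card (D \<inter> V))}" for f D
  let ?\<phi> = "\<lambda>D. (odds a D, odds b D)"
  have sub: "?\<phi> ` Pow S \<subseteq> Pow (orbs S a) \<times> Pow (orbs S b)" by (auto simp: odds_def)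
  have "\<not> inj_on ?\<phi> (Pow S)"
  proof
    assume "inj_on ?\<phi> (Pow S)"
    then have "card (Pow S) \<le> card (Pow (orbs S a) \<times> Pow (orbs S b))"
      using sub S by (intro card_inj_on_le[where f = ?\<phi>]) auto
    then have "(2::nat) ^ card S \<le> 2 ^ (card (orbs S a) + card (orbs S b))"
      using S by (simp add: card_Pow card_cartesian_product power_add)
    then show False using less by simp
  qed
  then obtain D1 D2 where D: "D1 \<subseteq> S" "D2 \<subseteq> S" "D1 \<noteq> D2"
    and oa: "odds a D1 = odds a D2" and ob: "odds b D1 = odds b D2"
    unfolding inj_on_def by auto
  define D where "D = (D1 - D2) \<union> (D2 - D1)"
  have DS: "D \<subseteq> S" and "D \<noteq> {}" using D by (auto simp: D_def)
  have even_orbit: "even (card (D \<inter> V))" if V: "V \<in> orbs S f" "odds f D1 = odds f D2" for f V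
  proof -
    have par: "odd (card (D1 \<inter> V)) \<longleftrightarrow> odd (card (D2 \<inter> V))"
      using that unfolding odds_def by blast
    have fin: "finite D1" "finite D2" using D S finite_subset by auto
    have eq: "D \<inter> V = (D1 \<inter> V - D2) \<union> (D2 \<inter> V - D1)" by (auto simp: D_def)
    have "card (D \<inter> V) = card (D1 \<inter> V - D2) + card (D2 \<inter> V - D1)"
      unfolding eq using fin by (intro card_Un_disjoint) auto
    moreover have "card (D1 \<inter> V) = card (D1 \<inter> V - D2) + card (D1 \<inter> D2 \<inter> V)"
      using fin by (subst card_Un_disjoint[symmetric]) (auto intro: arg_cong[of _ _ card])
    moreover have "card (D2 \<inter> V) = card (D2 \<inter> V - D1) + card (D1 \<inter> D2 \<inter> V)"
      using fin by (subst card_Un_disjoint[symmetric]) (auto intro: arg_cong[of _ _ card])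
    ultimately show ?thesis using par by presburger
  qed
  have even_closed: "even (card (D \<inter> X))"
    if f: "f permutes S" "odds f D1 = odds f D2"
      and X: "X \<subseteq> S" "\<And>w. w \<in> X \<Longrightarrow> f w \<in> X" for f X
  proof -
    have sub: "orbs X f \<subseteq> orbs S f" using X(1) by (auto simp: orbs_def)
    have "D \<inter> X = (\<Union>V\<in>orbs X f. D \<inter> V)"
      using Union_orbs_closed[OF f(1) S X(2)] by blast
    also have "card \<dots> = (\<Sum>V\<in>orbs X f. card (D \<inter> V))"
    proof (rule card_UN_disjoint)
      show "finite (orbs X f)" using finite_subset[OF X(1) S] by simp
      show "\<forall>V\<in>orbs X f. finite (D \<inter> V)" using finite_subset[OF DS S] by simp
      show "\<forall>V\<in>orbs X f. \<forall>W\<in>orbs X f. V \<noteq> W \<longrightarrow> (D \<inter> V) \<inter> (D \<inter> W) = {}"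
        using orbs_disjoint[OF f(1) S] sub by blast
    qed
    also have "even \<dots>" using even_orbit[OF _ f(2)] sub by (intro dvd_sum) auto
    finally show ?thesis .
  qed
  show ?thesis using that[OF DS \<open>D \<noteq> {}\<close>] even_closed[OF a oa] even_closed[OF b ob] by blast
qed

lemma card_orbs_double_merge:
  assumes C: "C permutes S" "finite S" and S: "p \<in> S" "q \<in> S" "x \<in> S" "y \<in> S"
    and neq: "orbit C p \<noteq> orbit C q" "orbit C x \<noteq> orbit C y"
      "{orbit C p, orbit C q} \<noteq> {orbit C x, orbit C y}"
  shows "card (orbs S (C \<circ> tr p q \<circ> tr x y)) + 2 = card (orbs S C)"
proof -
  note eq = orbit_eq_if_mem[OF C]
  have qp: "q \<notin> orbit C p" using neq(1) eq[of q p] by auto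
  let ?E = "C \<circ> tr p q"
  have E: "?E permutes S" by (rule permutes_comp_tr[OF C(1) S(1,2)])
  have "y \<notin> orbit ?E x"
  proof (cases "x \<in> orbit C p \<union> orbit C q")
    case True
    then have x: "orbit C x = orbit C p \<or> orbit C x = orbit C q" using eq[of x p] eq[of x q] by auto
    have "y \<notin> orbit C p \<union> orbit C q"
    proof
      assume "y \<in> orbit C p \<union> orbit C q"
      then have "orbit C y = orbit C p \<or> orbit C y = orbit C q" using eq[of y p] eq[of y q] by auto
      then show False using x neq by auto
    qed
    then show ?thesis using orbit_merge[OF C S(1,2) qp, of x] True by simp
  next
    case False
    then have "orbit ?E x = orbit C x" using orbit_merge[OF C S(1,2) qp, of x] by simp
    then show ?thesis using neq(2) eq[of y x] by auto
  qed
  from card_orbs_merge[OF E C(2) S(3,4) this] card_orbs_merge[OF C S(1,2) qp]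
  show ?thesis by simp
qed

text \<open>
  Regard a point v as an edge from the cycle of v to the cycle of b v, both taken with respect to
  C = a b. For two points v and w, the move that conjugates b by the transposition of b v and b w
  lowers the number of cycles by two, unless the edges v and w start in the same cycle, end in the
  same cycle, or the two starting cycles are also the two final ones. If the edge p joins two
  different cycles, then some edge z starts and some edge w ends in a third cycle, and the
  conditions for the three pairs of edges p, z and w contradict each other.
\<close>

lemma locally_minimal_imp_invariant:
  assumes a: "a permutes S" and b: "b permutes S" and S: "finite S"
    and three: "3 \<le> card (orbs S (a \<circ> b))"
    and min: "\<And>x y. x \<in> S \<Longrightarrow> y \<in> S \<Longrightarrow>
      card (orbs S (a \<circ> b)) \<le> card (orbs S (a \<circ> (tr x y \<circ> b \<circ> tr x y)))"
    and p: "p \<in> S"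
  shows "orbit (a \<circ> b) (b p) = orbit (a \<circ> b) p"
proof (rule ccontr)
  define C where "C = a \<circ> b"
  have C: "C permutes S" unfolding C_def by (rule permutes_compose[OF b a])
  have bS: "b z \<in> S" if "z \<in> S" for z using that permutes_in_image[OF b] by simp
  have stuck: "orbit C v = orbit C w \<or> orbit C (b v) = orbit C (b w) \<or>
     {orbit C v, orbit C w} = {orbit C (b v), orbit C (b w)}" if vw: "v \<in> S" "w \<in> S" for v w
  proof (rule ccontr)
    assume "\<not> ?thesis"
    then have "card (orbs S (C \<circ> tr v w \<circ> tr (b v) (b w))) + 2 = card (orbs S C)"
      using vw bS by (intro card_orbs_double_merge[OF C S]) auto
    then show False
      using min[OF bS[OF vw(1)] bS[OF vw(2)]] comp_conj_tr[OF b, of a v w] C_def by simp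
  qed
  assume "orbit (a \<circ> b) (b p) \<noteq> orbit (a \<circ> b) p"
  then have ij: "orbit C (b p) \<noteq> orbit C p" by (simp add: C_def)
  have "\<not> orbs S C \<subseteq> {orbit C p, orbit C (b p)}"
  proof
    assume "orbs S C \<subseteq> {orbit C p, orbit C (b p)}"
    then have "card (orbs S C) \<le> card {orbit C p, orbit C (b p)}" by (intro card_mono) auto
    also have "\<dots> \<le> 2" by (simp add: card_insert_if)
    finally show False using three by (simp add: C_def)
  qed
  then obtain z where z: "z \<in> S" "orbit C z \<noteq> orbit C p" "orbit C z \<noteq> orbit C (b p)"
    by (auto simp: orbs_def)
  define w where "w = inv' b z"
  have w: "w \<in> S" "b w = z"
    using z(1) permutes_in_image[OF permutes_inv[OF b]] permutes_inverses(1)[OF b]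
    by (auto simp: w_def)
  have bz: "orbit C (b z) = orbit C (b p)"
    using stuck[OF p z(1)] z ij by (auto simp: doubleton_eq_iff)
  have ow: "orbit C w = orbit C p"
    using stuck[OF p w(1)] z ij w(2) by (auto simp: doubleton_eq_iff)
  show False using stuck[OF z(1) w(1)] z ij bz ow w(2) by (auto simp: doubleton_eq_iff)
qed

text \<open>
  Choose a conjugate b for which C = a b has the least number m of cycles, and suppose that m is at
  least 3. By minimality, b and a preserve each cycle of C. Take D as in parity_set, x in D, and
  y in a cycle of C other than the cycle O of x. The move that conjugates b by the transposition of
  x and y joins the two cycles and splits them again, so it keeps the number of cycles minimal and
  the new cycles are invariant as well. Let U be the new cycle of x; it does not contain y. Then the
  intersection of U and O is invariant under a, and without x it is invariant under b. Both sets meet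
  D in an even number of points, although they differ by the point x of D.
\<close>

lemma exists_conj_le_two_cycles:
  assumes a: "a permutes S" and b0: "b\<^sub>0 permutes S" and S: "finite S"
    and less: "card (orbs S a) + card (orbs S b\<^sub>0) < card S"
  shows "\<exists>h. h permutes S \<and> card (orbs S (a \<circ> (h \<circ> b\<^sub>0 \<circ> inv' h))) \<le> 2"
proof -
  define m where "m h = card (orbs S (a \<circ> (h \<circ> b\<^sub>0 \<circ> inv' h)))" for h
  obtain h where h: "h permutes S" and min: "\<And>h'. h' permutes S \<Longrightarrow> m h \<le> m h'"
    using ex_has_least_nat[of "\<lambda>h. h permutes S" id m] permutes_id by blast
  show ?thesis
  proof (rule ccontr)
    assume "\<not> ?thesis"
    then have three: "3 \<le> m h" using h unfolding m_def by (metis not_less_eq_eq numeral_2_eq_2 numeral_3_eq_3)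
    define b where "b = h \<circ> b\<^sub>0 \<circ> inv' h"
    have b: "b permutes S" unfolding b_def by (rule permutes_conj[OF b0 h])
    have conj2: "m (g \<circ> h) = card (orbs S (a \<circ> (g \<circ> b \<circ> inv' g)))" if "g permutes S" for g
    proof -
      have "inv' (g \<circ> h) = inv' h \<circ> inv' g"
        by (rule o_inv_distrib[OF permutes_bij[OF that] permutes_bij[OF h]])
      then show ?thesis unfolding m_def b_def by (simp add: o_assoc)
    qed
    have inv2: "orbit (a \<circ> c) (c p) = orbit (a \<circ> c) p"
      if c: "c = g \<circ> b \<circ> inv' g" "g permutes S" "card (orbs S (a \<circ> c)) \<le> m h" "p \<in> S" for c g p
    proof (rule locally_minimal_imp_invariant[OF a _ S _ _ c(4)])
      show cS: "c permutes S" unfolding c(1) by (rule permutes_conj[OF b c(2)])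
      have "m h \<le> card (orbs S (a \<circ> c))"
        using min[of "g \<circ> h"] conj2[OF c(2)] permutes_compose[OF h c(2)] c(1) by simp
      then show "3 \<le> card (orbs S (a \<circ> c))" using three by simp
      fix x y assume xy: "x \<in> S" "y \<in> S"
      have tg: "tr x y \<circ> g permutes S" by (rule permutes_compose[OF c(2) permutes_swap_id[OF xy]])
      have "inv' (tr x y \<circ> g) = inv' g \<circ> tr x y"
        using o_inv_distrib[OF _ permutes_bij[OF c(2)], of "tr x y"] by simp
      then have "tr x y \<circ> c \<circ> tr x y = (tr x y \<circ> g) \<circ> b \<circ> inv' (tr x y \<circ> g)"
        unfolding c(1) by (simp add: o_assoc)
      then have "card (orbs S (a \<circ> (tr x y \<circ> c \<circ> tr x y))) = m ((tr x y \<circ> g) \<circ> h)"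
        using conj2[OF tg] by simp
      then show "card (orbs S (a \<circ> c)) \<le> card (orbs S (a \<circ> (tr x y \<circ> c \<circ> tr x y)))"
        using min[of "(tr x y \<circ> g) \<circ> h"] permutes_compose[OF h tg] c(3) by simp
    qed
    define C where "C = a \<circ> b"
    have C: "C permutes S" unfolding C_def by (rule permutes_compose[OF b a])
    note selfC = self_in_orbit[OF C S]
    have mh: "m h = card (orbs S C)" by (simp add: m_def C_def b_def)
    have diag: "orbit C (b p) = orbit C p" if "p \<in> S" for p
      using inv2[of b id p] that permutes_id mh by (simp add: C_def)
    have less': "card (orbs S a) + card (orbs S b) < card S"
      using less card_orbs_conj[OF b0 h S] by (simp add: b_def)
    obtain D where D: "D \<subseteq> S" "D \<noteq> {}"
      and Da: "\<And>X. X \<subseteq> S \<Longrightarrow> (\<And>w. w \<in> X \<Longrightarrow> a w \<in> X) \<Longrightarrow> even (card (D \<inter> X))"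
      and Db: "\<And>X. X \<subseteq> S \<Longrightarrow> (\<And>w. w \<in> X \<Longrightarrow> b w \<in> X) \<Longrightarrow> even (card (D \<inter> X))"
      using parity_set[OF a b S less'] by blast
    obtain x where x: "x \<in> D" "x \<in> S" using D by blast
    have "\<not> orbs S C \<subseteq> {orbit C x}"
      using three mh card_mono[of "{orbit C x}" "orbs S C"] by auto
    then obtain y where y: "y \<in> S" "orbit C y \<noteq> orbit C x" by (auto simp: orbs_def)
    define p q where "p = inv' b x" and "q = inv' b y"
    have p: "p \<in> S" "b p = x" and q: "q \<in> S" "b q = y"
      using x(2) y(1) permutes_in_image[OF permutes_inv[OF b]] permutes_inverses(1)[OF b]
      by (auto simp: p_def q_def)
    have op: "orbit C p = orbit C x" and oq: "orbit C q = orbit C y" using diag p q by auto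
    have qp: "q \<notin> orbit C p" using op oq y(2) orbit_eq_if_mem[OF C S, of q p] by auto
    define b' where "b' = tr x y \<circ> b \<circ> inv' (tr x y)"
    define C' where "C' = a \<circ> b'"
    have C'_eq: "C' = C \<circ> tr p q \<circ> tr x y"
      using comp_conj_tr[OF b, of a p q] p q by (simp add: C'_def C_def b'_def)
    let ?E = "C \<circ> tr p q"
    have E: "?E permutes S" by (rule permutes_comp_tr[OF C p(1) q(1)])
    have C': "C' permutes S" unfolding C'_eq by (rule permutes_comp_tr[OF E x(2) y(1)])
    have "card (orbs S C') \<le> m h"
      using card_orbs_comp_tr_le[OF E S x(2) y(1)] card_orbs_merge[OF C S p(1) q(1) qp]
      unfolding C'_eq mh by simp
    then have diag': "orbit C' (b' v) = orbit C' v" if "v \<in> S" for v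
      unfolding C'_def using inv2[OF b'_def permutes_swap_id[OF x(2) y(1)] _ that]
      by (simp add: C'_def)
    have "orbit ?E x = orbit C p \<union> orbit C q"
      using orbit_merge[OF C S p(1) q(1) qp, of x] op selfC by simp
    then have "y \<in> orbit ?E x" using oq selfC by simp
    moreover have xy: "x \<noteq> y" using y(2) by auto
    ultimately have yU: "y \<notin> orbit C' x"
      unfolding C'_eq by (intro orbit_split[OF E S x(2) y(1)])
    define U where "U = orbit C' x"
    have US: "U \<subseteq> S" unfolding U_def by (rule orbit_subset_carrier[OF C' x(2)])
    have xU: "x \<in> U" unfolding U_def by (rule self_in_orbit[OF C' S])
    have b'U: "b' v \<in> U \<longleftrightarrow> v \<in> U" if "v \<in> S" for v
    proof -
      have "b' v \<in> S" using that permutes_in_image[OF permutes_conj[OF b permutes_swap_id[OF x(2) y(1)]]]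
        unfolding b'_def by simp
      then show ?thesis
        using diag'[OF that] orbit_eq_if_mem[OF C' S] self_in_orbit[OF C' S] unfolding U_def by metis
    qed
    have aU: "a v \<in> U" if "v \<in> U" for v
    proof -
      let ?w = "inv' b' v"
      have b'S: "b' permutes S" unfolding b'_def by (rule permutes_conj[OF b permutes_swap_id[OF x(2) y(1)]])
      have w: "?w \<in> S" "b' ?w = v"
        using that US permutes_in_image[OF permutes_inv[OF b'S]] permutes_inverses(1)[OF b'S] by auto
      then have "?w \<in> U" using b'U[OF w(1)] that by simp
      then have "C' ?w \<in> U" unfolding U_def by (rule orbit.step)
      then show ?thesis using w(2) by (simp add: C'_def)
    qed
    have O_b: "b v \<in> orbit C x \<longleftrightarrow> v \<in> orbit C x" if "v \<in> S" for v
      using diag[OF that] orbit_eq_if_mem[OF C S] selfC by metis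
    have O_a: "a v \<in> orbit C x" if "v \<in> orbit C x" for v
    proof -
      let ?w = "inv' b v"
      have w: "?w \<in> S" "b ?w = v"
        using that orbit_subset_carrier[OF C x(2)] permutes_in_image[OF permutes_inv[OF b]]
          permutes_inverses(1)[OF b] by auto
      then have "?w \<in> orbit C x" using O_b[OF w(1)] that by simp
      then have "C ?w \<in> orbit C x" by (rule orbit.step)
      then show ?thesis using w(2) by (simp add: C_def)
    qed
    have yO: "y \<notin> orbit C x" using y(2) orbit_eq_if_mem[OF C S, of y x] by auto
    \<comment> \<open>The parities of the next two sets contradict each other.\<close>
    have "even (card (D \<inter> (U \<inter> orbit C x)))" using US aU O_a by (intro Da) auto
    moreover have "even (card (D \<inter> (U \<inter> orbit C x - {x})))"
    proof (rule Db)
      show "U \<inter> orbit C x - {x} \<subseteq> S" using US by blast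
      fix w assume w: "w \<in> U \<inter> orbit C x - {x}"
      then have wS: "w \<in> S" and wy: "w \<noteq> x" "w \<noteq> y" using US yO by auto
      have "b w \<in> orbit C x" using O_b[OF wS] w by simp
      moreover have "tr x y (b w) \<in> U" using b'U[OF wS] w wy by (simp add: b'_def)
      moreover have "b w \<noteq> y" using calculation(1) yO by auto
      ultimately show "b w \<in> U \<inter> orbit C x - {x}"
        using yU by (cases "b w = x") (auto simp: U_def)
    qed
    moreover have "D \<inter> (U \<inter> orbit C x) = insert x (D \<inter> (U \<inter> orbit C x - {x}))"
      using x xU selfC by blast
    then have "card (D \<inter> (U \<inter> orbit C x)) = Suc (card (D \<inter> (U \<inter> orbit C x - {x})))"
      using finite_subset[OF D(1) S] by (metis DiffD2 IntD2 card_insert_disjoint finite_Int singletonI)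
    ultimately show False by simp
  qed
qed

text \<open>
  The sign of the product decides between one and two cycles.
\<close>

lemma exists_conj_one_cycle:
  assumes a: "a permutes S" and b: "b permutes S" and S: "finite S"
    and less: "card (orbs S a) + card (orbs S b) < card S"
    and parity: "odd (card (orbs S a) + card (orbs S b) + card S)"
  obtains h where "h permutes S" "orbs S (a \<circ> (h \<circ> b \<circ> inv' h)) = {S}"
proof -
  obtain h where h: "h permutes S" and le: "card (orbs S (a \<circ> (h \<circ> b \<circ> inv' h))) \<le> 2"
    using exists_conj_le_two_cycles[OF a b S less] by blast
  let ?b = "h \<circ> b \<circ> inv' h" let ?C = "a \<circ> ?b"
  have b': "?b permutes S" by (rule permutes_conj[OF b h])
  have C: "?C permutes S" by (rule permutes_compose[OF b' a])
  have "evenperm ?C \<longleftrightarrow> (evenperm a \<longleftrightarrow> evenperm ?b)"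
    using evenperm_comp[OF permutation_if_permutes[OF a S] permutation_if_permutes[OF b' S]] .
  then have "odd (card (orbs S ?C))"
    unfolding evenperm_iff_orbs[OF S C] evenperm_iff_orbs[OF S a] evenperm_iff_orbs[OF S b']
      card_orbs_conj[OF b h S] using parity by presburger
  then have "card (orbs S ?C) = 1" using le by (cases "card (orbs S ?C)") (auto simp: le_Suc_eq)
  then obtain V where V: "orbs S ?C = {V}" by (auto simp: card_1_singleton_iff)
  moreover have "\<Union>(orbs S ?C) = S"
    using permutes_in_image[OF C] by (intro Union_orbs_closed[OF C S]) simp
  ultimately have "orbs S ?C = {S}" by simp
  then show ?thesis using h by (rule that[rotated])
qed

section \<open>Cycle types\<close>

text \<open>The cycle type as a partition of the number of points; fixed points are parts 1.\<close>

definition ctype :: "'a set \<Rightarrow> ('a \<Rightarrow> 'a) \<Rightarrow> nat multiset" where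
  "ctype S f = image_mset card (mset_set (orbs S f))"

lemma size_ctype: "size (ctype S f) = card (orbs S f)"
  by (simp add: ctype_def)

lemma orbs_mem: "p \<in> S \<Longrightarrow> orbit f p \<in> orbs S f"
  by (simp add: orbs_def)

lemma sum_ctype:
  assumes f: "f permutes S" "finite S" shows "sum_mset (ctype S f) = card S"
proof -
  have "sum_mset (ctype S f) = (\<Sum>V\<in>orbs S f. card V)"
    by (simp add: ctype_def sum_unfold_sum_mset)
  also have "\<dots> = card (\<Union>(orbs S f))"
  proof (rule card_Union_disjoint[symmetric])
    show "pairwise disjnt (orbs S f)"
      using orbs_disjoint[OF f] by (auto simp: pairwise_def disjnt_def)
    show "finite V" if "V \<in> orbs S f" for V
      using that orbit_subset_carrier[OF f(1)] finite_subset[OF _ f(2)] by (auto simp: orbs_def)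
  qed
  also have "\<Union>(orbs S f) = S" using permutes_in_image[OF f(1)] by (intro Union_orbs_closed[OF f]) simp
  finally show ?thesis .
qed

lemma ctype_pos:
  assumes f: "f permutes S" "finite S" shows "0 \<notin># ctype S f"
proof
  assume "0 \<in># ctype S f"
  then obtain V where V: "V \<in> orbs S f" "card V = 0" using f(2) by (auto simp: ctype_def)
  then obtain z where "z \<in> S" "V = orbit f z" by (auto simp: orbs_def)
  then show False
    using V(2) finite_subset[OF orbit_subset_carrier[OF f(1)] f(2)] orbit_nonempty[of f z]
    by (metis card_eq_0_iff)
qed

lemma ctype_remove_orbit:
  assumes "finite S" "p \<in> S"
  shows "ctype S f = add_mset (card (orbit f p)) (image_mset card (mset_set (orbs S f - {orbit f p})))"
  using assms orbs_mem[OF assms(2), of f]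
  by (simp add: ctype_def mset_set.remove)

lemma ctype_insert_fixed:
  assumes "f permutes S" "finite S" "x \<notin> S"
  shows "ctype (insert x S) f = add_mset 1 (ctype S f)"
proof -
  have "{x} \<notin> orbs S f" using orbit_subset_carrier[OF assms(1)] assms(3) by (force simp: orbs_def)
  then show ?thesis using assms by (simp add: ctype_def orbs_insert_fixed)
qed

lemma ctype_insert_point:
  assumes f: "f permutes S" "finite S" "x \<notin> S" "p \<in> S"
    and ct: "ctype S f = add_mset (card (orbit f p)) M"
  shows "ctype (insert x S) (f \<circ> tr p x) = add_mset (Suc (card (orbit f p))) M"
proof -
  have M: "M = image_mset card (mset_set (orbs S f - {orbit f p}))"
    using ct ctype_remove_orbit[OF f(2,4), of f] by simp
  have "insert x (orbit f p) \<notin> orbs S f"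
    using orbit_subset_carrier[OF f(1)] f(3) by (force simp: orbs_def)
  moreover have "x \<notin> orbit f p" using orbit_subset_carrier[OF f(1,4)] f(3) by blast
  moreover have "finite (orbit f p)" using finite_subset[OF orbit_subset_carrier[OF f(1,4)] f(2)] .
  ultimately show ?thesis unfolding ctype_def orbs_insert_point[OF f(1-4)] using f(2) M by simp
qed

lemma ctype_add_msetE:
  assumes "finite S" "ctype S f = add_mset l M"
  obtains p where "p \<in> S" "card (orbit f p) = l"
proof -
  have "l \<in># ctype S f" using assms by simp
  then show ?thesis using that assms(1) by (auto simp: ctype_def orbs_def)
qed

lemma ctype_add_mset2E:
  assumes f: "f permutes S" "finite S" and ct: "ctype S f = add_mset l (add_mset m M)"
  obtains p q where "p \<in> S" "card (orbit f p) = l" "q \<in> S" "card (orbit f q) = m" "q \<notin> orbit f p"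
proof -
  obtain p where p: "p \<in> S" "card (orbit f p) = l" using ctype_add_msetE[OF f(2) ct] .
  have "add_mset m M = image_mset card (mset_set (orbs S f - {orbit f p}))"
    using ctype_remove_orbit[OF f(2) p(1), of f] ct p(2) by simp
  then have "m \<in># image_mset card (mset_set (orbs S f - {orbit f p}))" by (metis union_single_eq_member add_mset_add_single)
  then obtain V where "V \<in> orbs S f" "V \<noteq> orbit f p" "card V = m" using f(2) by auto
  then obtain q where q: "q \<in> S" "orbit f q \<noteq> orbit f p" "card (orbit f q) = m"
    by (auto simp: orbs_def)
  have "q \<notin> orbit f p" using q(2) orbit_eq_if_mem[OF f, of q p] by blast
  then show ?thesis using p q by (intro that[of p q])
qed

lemma exists_ctype:
  assumes "0 \<notin># M" "finite S" "card S = sum_mset M"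
  shows "\<exists>f. f permutes S \<and> ctype S f = M"
  using assms
proof (induction "card S" arbitrary: S M)
  case 0
  then have "M = {#}" by (metis card_0_eq multiset_nonemptyE sum_mset_0_iff)
  then show ?case using 0 by (intro exI[of _ id]) (auto simp: ctype_def orbs_def)
next
  case (Suc n)
  then obtain x where x: "x \<in> S" by (metis card.empty ex_in_conv nat.distinct(1))
  define T where "T = S - {x}"
  have T: "finite T" "x \<notin> T" "S = insert x T" "card T = n" using Suc.prems Suc.hyps(2) x by (auto simp: T_def)
  obtain l where l: "l \<in># M" using Suc by (metis multiset_nonemptyE sum_mset.empty nat.distinct(1))
  then obtain M' where M: "M = add_mset l M'" by (metis mset_add)
  have "l \<noteq> 0" using Suc.prems(1) l by metis
  show ?case
  proof (cases "l = 1")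
    case True
    then obtain f where "f permutes T" "ctype T f = M'"
      using Suc.hyps(1)[of T M'] Suc.hyps(2) Suc.prems T M by auto
    then show ?thesis using T ctype_insert_fixed[of f T x] True M
      by (intro exI[of _ f]) (auto intro: permutes_subset)
  next
    case False
    then obtain j where j: "l = Suc j" "j \<noteq> 0" using \<open>l \<noteq> 0\<close> by (cases l) auto
    obtain f where f: "f permutes T" "ctype T f = add_mset j M'"
      using Suc.hyps(1)[of T "add_mset j M'"] Suc.hyps(2) Suc.prems T M j by auto
    obtain p where p: "p \<in> T" "card (orbit f p) = j" using ctype_add_msetE[OF T(1) f(2)] .
    have "ctype S (f \<circ> tr p x) = M"
      unfolding T(3) using ctype_insert_point[OF f(1) T(1,2) p(1), of M'] f(2) p(2) M j by simp
    then show ?thesis using permutes_insert_point[OF f(1) p(1), of x] T(3) by metis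
  qed
qed

section \<open>Pairs of permutations as maps with one large face\<close>

definition single_cycle :: "'a set \<Rightarrow> ('a \<Rightarrow> 'a) \<Rightarrow> bool" where
  "single_cycle Y f \<longleftrightarrow> f permutes Y \<and> (\<forall>z\<in>Y. orbit f z = Y)"

lemma single_cycle_insert:
  assumes C: "single_cycle Y C" "finite Y" "x \<notin> Y" "q \<in> Y"
  shows "single_cycle (insert x Y) (C \<circ> tr q x)"
proof -
  have C': "C permutes Y" "orbit C q = Y" using C by (auto simp: single_cycle_def)
  have "\<forall>z\<in>insert x Y. orbit (C \<circ> tr q x) z = insert x Y"
    using orbit_insert_point[OF C'(1) C(2-4)] C'(2) by simp
  then show ?thesis unfolding single_cycle_def using permutes_insert_point[OF C'(1) C(4)] by blast
qed

text \<open>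
  A pair of permutations of S is a bipartite map on a surface: the points of S are the edges, the
  cycles of a and of b are the black and the white vertices, and the cycles of a b are the faces.
  The map has one large face, with the points Y, and all points outside Y are fixed by a b, so each
  of them spans a face bounded by two parallel edges. Every vertex lies on the large face, which
  allows further edges to be attached at any vertex. The next lemmas are the three ways to add edges:
  a new edge ends in a new black vertex and leaves the large face in one piece; a new edge runs
  parallel to an old one and cuts off a small face; two new edges that share a vertex leave the large
  face in one piece when they are placed well.
\<close>

definition unicellular :: "'a set \<Rightarrow> ('a \<Rightarrow> 'a) \<Rightarrow> ('a \<Rightarrow> 'a) \<Rightarrow> 'a set \<Rightarrow> bool" where
  "unicellular S a b Y \<longleftrightarrow> a permutes S \<and> b permutes S \<and> Y \<subseteq> S \<and> single_cycle Y (a \<circ> b) \<and>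
     (\<forall>z\<in>S. orbit a z \<inter> Y \<noteq> {} \<and> orbit b z \<inter> Y \<noteq> {})"

lemma orbit_insert_point_meets:
  assumes f: "f permutes S" "finite S" "x \<notin> S" "p \<in> S" and meets: "\<And>z. z \<in> S \<Longrightarrow> orbit f z \<inter> Y \<noteq> {}"
    and z: "z \<in> insert x S"
  shows "orbit (f \<circ> tr p x) z \<inter> Y \<noteq> {}"
  using orbit_insert_point[OF f, of z] meets[OF f(4)] meets[of z] z by auto

lemma tr_comp_permutes:
  assumes "b permutes S" "r \<notin> S" shows "tr (b u) r \<circ> b = b \<circ> tr u r"
proof
  fix z
  show "(tr (b u) r \<circ> b) z = (b \<circ> tr u r) z"
    using injD[OF permutes_inj[OF assms(1)], of z u] injD[OF permutes_inj[OF assms(1)], of z r]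
      permutes_not_in[OF assms]
    by (auto simp: Transposition.transpose_def)
qed

lemma unicellular_pendant:
  assumes U: "unicellular S a b Y" and S: "finite S" and x: "x \<notin> S" and q: "q \<in> Y"
  shows "unicellular (insert x S) a (b \<circ> tr q x) (insert x Y)"
proof -
  have a: "a permutes S" and b: "b permutes S" and Y: "Y \<subseteq> S" and C: "single_cycle Y (a \<circ> b)"
    and ma: "\<And>z. z \<in> S \<Longrightarrow> orbit a z \<inter> Y \<noteq> {}" and mb: "\<And>z. z \<in> S \<Longrightarrow> orbit b z \<inter> Y \<noteq> {}"
    using U by (auto simp: unicellular_def)
  have qS: "q \<in> S" using q Y by blast
  have "a permutes insert x S" by (rule permutes_subset[OF a]) auto
  moreover have "single_cycle (insert x Y) (a \<circ> (b \<circ> tr q x))"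
    unfolding o_assoc using single_cycle_insert[OF C _ _ q] finite_subset[OF Y S] Y x by blast
  moreover have "orbit a z \<inter> insert x Y \<noteq> {}" if "z \<in> insert x S" for z
    using that ma[of z] orbit_fixpoint[of a x] permutes_not_in[OF a x] by (cases "z = x") auto
  moreover have "orbit (b \<circ> tr q x) z \<inter> insert x Y \<noteq> {}" if "z \<in> insert x S" for z
    using orbit_insert_point_meets[OF b S x qS mb that] by blast
  ultimately show ?thesis unfolding unicellular_def
    using permutes_insert_point[OF b qS, of x] Y by blast
qed

lemma unicellular_duplicate:
  assumes U: "unicellular S a b Y" and S: "finite S" and x: "x \<notin> S" and q: "q \<in> Y"
  shows "unicellular (insert x S) (a \<circ> tr (b q) x) (b \<circ> tr q x) Y"
proof -
  have a: "a permutes S" and b: "b permutes S" and Y: "Y \<subseteq> S" and C: "single_cycle Y (a \<circ> b)"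
    and ma: "\<And>z. z \<in> S \<Longrightarrow> orbit a z \<inter> Y \<noteq> {}" and mb: "\<And>z. z \<in> S \<Longrightarrow> orbit b z \<inter> Y \<noteq> {}"
    using U by (auto simp: unicellular_def)
  have qS: "q \<in> S" using q Y by blast
  have bq: "b q \<in> S" using permutes_in_image[OF b] qS by simp
  have "a \<circ> tr (b q) x \<circ> (b \<circ> tr q x) = a \<circ> (tr (b q) x \<circ> b) \<circ> tr q x" by (simp add: o_assoc)
  also have "\<dots> = a \<circ> b" unfolding tr_comp_permutes[OF b x] by (simp add: fun_eq_iff)
  finally have "a \<circ> tr (b q) x \<circ> (b \<circ> tr q x) = a \<circ> b" .
  moreover have "orbit (a \<circ> tr (b q) x) z \<inter> Y \<noteq> {}" if "z \<in> insert x S" for z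
    using orbit_insert_point_meets[OF a S x bq ma that] .
  moreover have "orbit (b \<circ> tr q x) z \<inter> Y \<noteq> {}" if "z \<in> insert x S" for z
    using orbit_insert_point_meets[OF b S x qS mb that] .
  ultimately show ?thesis unfolding unicellular_def
    using permutes_insert_point[OF a bq, of x] permutes_insert_point[OF b qS, of x] C Y by auto
qed

text \<open>
  The first edge x cuts the large face into two, and both parts touch the two vertices that x
  joins. The second edge y starts at the point q2, which lies in one of the parts. Its other end can
  be placed at the black vertex of x in the other part, and then y joins the two parts again. The
  point r tells which of the two places at this vertex is used.
\<close>

lemma unicellular_pair:
  assumes U: "unicellular S a b Y" and S: "finite S" and xy: "x \<notin> S" "y \<notin> S" "x \<noteq> y"
    and Ys: "u \<in> Y" "q1 \<in> Y" "q2 \<in> Y"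
  obtains r where "r \<in> {b u, x}"
    "unicellular (insert y (insert x S)) (a \<circ> tr (b u) x \<circ> tr r y) (b \<circ> tr q1 x \<circ> tr q2 y)
       (insert y (insert x Y))"
proof -
  have a: "a permutes S" and b: "b permutes S" and Y: "Y \<subseteq> S" and C: "single_cycle Y (a \<circ> b)"
    and ma: "\<And>z. z \<in> S \<Longrightarrow> orbit a z \<inter> Y \<noteq> {}" and mb: "\<And>z. z \<in> S \<Longrightarrow> orbit b z \<inter> Y \<noteq> {}"
    using U by (auto simp: unicellular_def)
  have in_S: "u \<in> S" "q1 \<in> S" "q2 \<in> S" using Ys Y by auto
  have bu: "b u \<in> S" using permutes_in_image[OF b] in_S by simp
  have Yx: "x \<notin> Y" "y \<notin> insert x Y" and finY: "finite Y" using Y xy finite_subset[OF Y S] by auto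
  let ?a1 = "a \<circ> tr (b u) x" let ?b1 = "b \<circ> tr q1 x"
  let ?D = "a \<circ> b \<circ> tr u x" let ?C1 = "?D \<circ> tr q1 x"
  have a1: "?a1 permutes insert x S" by (rule permutes_insert_point[OF a bu])
  have b1: "?b1 permutes insert x S" by (rule permutes_insert_point[OF b in_S(2)])
  have C1_eq: "?a1 \<circ> ?b1 = ?C1"
  proof -
    have "?a1 \<circ> ?b1 = a \<circ> (tr (b u) x \<circ> b) \<circ> tr q1 x" by (simp add: o_assoc)
    then show ?thesis unfolding tr_comp_permutes[OF b xy(1)] by (simp add: o_assoc)
  qed
  have D: "single_cycle (insert x Y) ?D" by (rule single_cycle_insert[OF C finY Yx(1) Ys(1)])
  then have Dp: "?D permutes insert x Y" and Do: "\<And>z. z \<in> insert x Y \<Longrightarrow> orbit ?D z = insert x Y"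
    by (auto simp: single_cycle_def)
  have finYx: "finite (insert x Y)" using finY by simp
  have q1x: "q1 \<noteq> x" using Ys(2) Yx(1) by auto
  have C1p: "?C1 permutes insert x Y" by (rule permutes_comp_tr[OF Dp]) (use Ys in auto)
  have split: "x \<notin> orbit ?C1 q1"
    by (rule orbit_split[OF Dp finYx _ _ q1x]) (use Ys Do in auto)
  note C1self = self_in_orbit[OF C1p finYx]
  have cover: "orbit ?C1 q1 \<union> orbit ?C1 x = insert x Y"
  proof -
    have "orbit (?C1 \<circ> tr q1 x) q1 = orbit ?C1 q1 \<union> orbit ?C1 x"
      using orbit_merge[OF C1p finYx _ _ split, of q1] Ys C1self by simp
    then show ?thesis using Do[of q1] Ys by (simp add: tr_tr_comp)
  qed
  \<comment> \<open>The point u2 lies in the part that does not contain q2, and the place for y at the black vertex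
    is reached from it.\<close>
  obtain r u2 where r: "r \<in> {b u, x}" and u2: "?b1 u2 = r" "u2 \<in> insert x Y" "q2 \<notin> orbit ?C1 u2"
    "orbit ?C1 u2 \<union> orbit ?C1 q2 = insert x Y"
  proof (cases "q2 \<in> orbit ?C1 x")
    case True
    have eq: "orbit ?C1 q2 = orbit ?C1 x" by (rule orbit_eq_if_mem[OF C1p finYx True])
    have bq1: "?b1 q1 = x" using permutes_not_in[OF b xy(1)] by simp
    have nq2: "q2 \<notin> orbit ?C1 q1"
    proof
      assume "q2 \<in> orbit ?C1 q1"
      then have "orbit ?C1 q2 = orbit ?C1 q1" by (rule orbit_eq_if_mem[OF C1p finYx])
      then show False using split eq C1self[of x] by simp
    qed
    show ?thesis
      by (rule that[of x q1]) (use bq1 Ys nq2 cover eq in simp_all)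
  next
    case False
    define z where "z = tr q1 x u"
    have z: "z \<in> insert x Y" "?b1 z = b u" using Ys by (auto simp: z_def Transposition.transpose_def)
    have ax: "(a \<circ> b) x = x" using permutes_not_in[OF b xy(1)] permutes_not_in[OF a xy(1)] by simp
    have "?C1 z = x" using ax by (simp add: z_def)
    then have "orbit ?C1 z = orbit ?C1 x" using orbit_f[OF C1p finYx, of z] by metis
    moreover have "q2 \<in> orbit ?C1 q1" using cover False Ys(3) by blast
    then have "orbit ?C1 q2 = orbit ?C1 q1" by (rule orbit_eq_if_mem[OF C1p finYx])
    ultimately show ?thesis
      by (intro that[of "b u" z]) (use z False cover in auto)
  qed
  let ?a2 = "?a1 \<circ> tr r y" let ?b2 = "?b1 \<circ> tr q2 y"
  let ?E = "?C1 \<circ> tr u2 y"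
  have yS: "y \<notin> insert x S" using xy by simp
  have C2_eq: "?a2 \<circ> ?b2 = ?E \<circ> tr q2 y"
  proof -
    have "?a2 \<circ> ?b2 = ?a1 \<circ> (tr (?b1 u2) y \<circ> ?b1) \<circ> tr q2 y" unfolding u2(1) by (simp only: o_assoc)
    also have "\<dots> = (?a1 \<circ> ?b1) \<circ> tr u2 y \<circ> tr q2 y"
      unfolding tr_comp_permutes[OF b1 yS] by (simp only: o_assoc)
    finally show ?thesis unfolding C1_eq .
  qed
  let ?Y = "insert y (insert x Y)"
  have Ep: "?E permutes ?Y" by (rule permutes_insert_point[OF C1p u2(2)])
  have q2: "q2 \<in> insert x Y" "q2 \<noteq> y" using Ys(3) Yx by auto
  note Eorb = orbit_insert_point[OF C1p finYx Yx(2) u2(2)]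
  have Ey: "orbit ?E y = insert y (orbit ?C1 u2)" using Eorb[of y] by simp
  have Eq2: "orbit ?E q2 = orbit ?C1 q2" using Eorb[of q2] u2(3) q2(2) by simp
  have "y \<notin> orbit ?E q2" unfolding Eq2 using orbit_subset_carrier[OF C1p q2(1)] Yx(2) by blast
  then have "orbit (?E \<circ> tr q2 y) z = ?Y" if "z \<in> ?Y" for z
    using orbit_merge[OF Ep _ _ _, of q2 y z] that finYx q2(1) Ey Eq2 u2(4) by auto
  then have "single_cycle ?Y (?a2 \<circ> ?b2)"
    unfolding C2_eq single_cycle_def using permutes_comp_tr[OF Ep, of q2 y] q2(1) by blast
  moreover have rS: "r \<in> insert x S" using r bu by auto
  have q2S: "q2 \<in> insert x S" using in_S by simp
  have finx: "finite (insert x S)" using S by simp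
  have "orbit ?a2 z \<inter> ?Y \<noteq> {}" if "z \<in> insert y (insert x S)" for z
    using orbit_insert_point_meets[OF a1 finx yS rS orbit_insert_point_meets[OF a S xy(1) bu ma] that]
    by blast
  moreover have "orbit ?b2 z \<inter> ?Y \<noteq> {}" if "z \<in> insert y (insert x S)" for z
    using orbit_insert_point_meets[OF b1 finx yS q2S orbit_insert_point_meets[OF b S xy(1) in_S(2) mb] that]
    by blast
  ultimately have "unicellular (insert y (insert x S)) ?a2 ?b2 ?Y" unfolding unicellular_def
    using permutes_insert_point[OF a1 rS, of y] permutes_insert_point[OF b1 q2S, of y] Y by blast
  then show ?thesis using r by (rule that[rotated])
qed

section \<open>Realizing cycle types with a large cycle and fixed points as product\<close>

text \<open>
  Permutations of the given cycle types exist on every carrier of the right size. Quantifying over all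
  carriers allows a proof to delete points of a given carrier, to realize smaller cycle types
  on the rest and to insert the deleted points again.
\<close>

definition realizable :: "nat multiset \<Rightarrow> nat multiset \<Rightarrow> nat \<Rightarrow> bool" where
  "realizable \<mu> \<nu> k \<longleftrightarrow> (\<forall>S::nat set. finite S \<longrightarrow> card S = sum_mset \<mu> \<longrightarrow>
     (\<exists>a b Y. unicellular S a b Y \<and> ctype S a = \<mu> \<and> ctype S b = \<nu> \<and> card S = card Y + k))"

text \<open>
  In addition, the point b q lies in a cycle of a of length l and in a cycle of b of length m, and it
  follows a point q of the large face. So this edge can be doubled, which lengthens exactly these
  two cycles.
\<close>

definition realizable_edge :: "nat \<Rightarrow> nat \<Rightarrow> nat multiset \<Rightarrow> nat multiset \<Rightarrow> nat \<Rightarrow> bool" where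
  "realizable_edge l m \<mu> \<nu> k \<longleftrightarrow> (\<forall>S::nat set. finite S \<longrightarrow> card S = l + sum_mset \<mu> \<longrightarrow>
     (\<exists>a b Y q. unicellular S a b Y \<and> ctype S a = add_mset l \<mu> \<and> ctype S b = add_mset m \<nu> \<and>
        card S = card Y + k \<and> q \<in> Y \<and> card (orbit a (b q)) = l \<and> card (orbit b q) = m))"

lemma realizable_edge_imp_realizable:
  "realizable_edge l m \<mu> \<nu> k \<Longrightarrow> realizable (add_mset l \<mu>) (add_mset m \<nu>) k"
  unfolding realizable_edge_def realizable_def by fastforce

lemma unicellular_orbit_meets:
  assumes "unicellular S a b Y" "z \<in> S"
  shows "orbit a z \<inter> Y \<noteq> {}" "orbit b z \<inter> Y \<noteq> {}"
  using assms by (auto simp: unicellular_def)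

lemma orbit_rep_b:
  assumes U: "unicellular S a b Y" and S: "finite S" and z: "z \<in> S"
  obtains q where "q \<in> Y" "q \<in> S" "orbit b q = orbit b z"
proof -
  have b: "b permutes S" "Y \<subseteq> S" using U by (auto simp: unicellular_def)
  obtain q where q: "q \<in> Y" "q \<in> orbit b z" using unicellular_orbit_meets(2)[OF U z] by blast
  then show ?thesis using that b(2) orbit_eq_if_mem[OF b(1) S q(2)] by blast
qed

lemma orbit_rep_a:
  assumes U: "unicellular S a b Y" and S: "finite S" and z: "z \<in> S"
  obtains u where "u \<in> Y" "u \<in> S" "b u \<in> S" "orbit a (b u) = orbit a z"
proof -
  have a: "a permutes S" and b: "b permutes S" and Y: "Y \<subseteq> S" and C: "(a \<circ> b) permutes Y"
    using U by (auto simp: unicellular_def single_cycle_def)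
  obtain v where v: "v \<in> Y" "v \<in> orbit a z" using unicellular_orbit_meets(1)[OF U z] by blast
  define u where "u = inv' (a \<circ> b) v"
  have u: "u \<in> Y" using permutes_in_image[OF permutes_inv[OF C]] v(1) by (simp add: u_def)
  have "a (b u) = v" using permutes_inverses(1)[OF C, of v] by (simp add: u_def)
  then have "orbit a (b u) = orbit a v" using orbit_f[OF a S, of "b u"] by simp
  also have "\<dots> = orbit a z" by (rule orbit_eq_if_mem[OF a S v(2)])
  finally show ?thesis using that u Y permutes_in_image[OF b] by blast
qed

lemma card_eq_SucE:
  assumes "finite S" "card S = Suc n"
  obtains x T where "S = insert x T" "x \<notin> T" "finite T" "card T = n"
  using assms by (metis card_Suc_eq finite_insert)

lemma realizable_pendant:
  assumes "realizable \<mu> (add_mset m \<nu>) k"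
  shows "realizable_edge 1 (Suc m) \<mu> \<nu> k"
  unfolding realizable_edge_def
proof (intro allI impI)
  fix S :: "nat set" assume "finite S" "card S = 1 + sum_mset \<mu>"
  then obtain x T where x: "S = insert x T" "x \<notin> T" and T: "finite T" "card T = sum_mset \<mu>"
    using card_eq_SucE[of S "sum_mset \<mu>"] by auto
  then obtain a b Y where U: "unicellular T a b Y" and ct: "ctype T a = \<mu>" "ctype T b = add_mset m \<nu>"
    and k: "card T = card Y + k" using assms unfolding realizable_def by blast
  have a: "a permutes T" and b: "b permutes T" and Y: "Y \<subseteq> T" using U by (auto simp: unicellular_def)
  obtain z where z: "z \<in> T" "card (orbit b z) = m" using ctype_add_msetE[OF T(1) ct(2)] .
  obtain q where q: "q \<in> Y" "q \<in> T" "orbit b q = orbit b z" using orbit_rep_b[OF U T(1) z(1)] .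
  let ?b = "b \<circ> tr q x"
  have "unicellular S a ?b (insert x Y)" unfolding x(1) by (rule unicellular_pendant[OF U T(1) x(2) q(1)])
  moreover have "ctype S a = add_mset 1 \<mu>" unfolding x(1) ctype_insert_fixed[OF a T(1) x(2)] ct(1) ..
  moreover have "ctype S ?b = add_mset (Suc m) \<nu>"
    unfolding x(1) using ctype_insert_point[OF b T(1) x(2) q(2)] ct(2) q(3) z(2) by simp
  moreover have "x \<notin> Y" "finite Y" using x(2) Y finite_subset[OF Y T(1)] by auto
  then have "card S = card (insert x Y) + k" using k x T by simp
  moreover have "card (orbit a (?b q)) = 1"
    using orbit_fixpoint[of a x] permutes_not_in[OF a x(2)] permutes_not_in[OF b x(2)] by simp
  moreover have "card (orbit ?b q) = Suc m"
    using orbit_insert_point[OF b T(1) x(2) q(2), of q] self_in_orbit[OF b T(1), of q] q(3) z(2)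
      orbit_subset_carrier[OF b z(1)] x(2) finite_subset[OF orbit_subset_carrier[OF b z(1)] T(1)]
    by (auto simp: card_insert_if)
  ultimately show "\<exists>a b Y q. unicellular S a b Y \<and> ctype S a = add_mset 1 \<mu> \<and>
    ctype S b = add_mset (Suc m) \<nu> \<and> card S = card Y + k \<and> q \<in> Y \<and>
    card (orbit a (b q)) = 1 \<and> card (orbit b q) = Suc m"
    using q(1) by blast
qed

lemma realizable_edge_duplicate:
  assumes "realizable_edge l m \<mu> \<nu> k"
  shows "realizable_edge (Suc l) (Suc m) \<mu> \<nu> (Suc k)"
  unfolding realizable_edge_def
proof (intro allI impI)
  fix S :: "nat set" assume "finite S" "card S = Suc l + sum_mset \<mu>"
  then obtain x T where x: "S = insert x T" "x \<notin> T" and T: "finite T" "card T = l + sum_mset \<mu>"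
    using card_eq_SucE[of S "l + sum_mset \<mu>"] by auto
  then obtain a b Y q where U: "unicellular T a b Y" and ct: "ctype T a = add_mset l \<mu>" "ctype T b = add_mset m \<nu>"
    and k: "card T = card Y + k" and q: "q \<in> Y" "card (orbit a (b q)) = l" "card (orbit b q) = m"
    using assms unfolding realizable_edge_def by blast
  have a: "a permutes T" and b: "b permutes T" and Y: "Y \<subseteq> T" using U by (auto simp: unicellular_def)
  have qT: "q \<in> T" "b q \<in> T" using q(1) Y permutes_in_image[OF b] by auto
  let ?a = "a \<circ> tr (b q) x" let ?b = "b \<circ> tr q x"
  have "unicellular S ?a ?b Y" unfolding x(1) by (rule unicellular_duplicate[OF U T(1) x(2) q(1)])
  moreover have "ctype S ?a = add_mset (Suc l) \<mu>"
    unfolding x(1) using ctype_insert_point[OF a T(1) x(2) qT(2)] ct(1) q(2) by simp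
  moreover have "ctype S ?b = add_mset (Suc m) \<nu>"
    unfolding x(1) using ctype_insert_point[OF b T(1) x(2) qT(1)] ct(2) q(3) by simp
  moreover have "card S = card Y + Suc k" using k x T by simp
  moreover have "?b q = x" using permutes_not_in[OF b x(2)] by simp
  then have "card (orbit ?a (?b q)) = Suc l"
    using card_orbit_insert_point[OF a T(1) x(2) qT(2), of x] q(2) by simp
  moreover have "card (orbit ?b q) = Suc m"
    using card_orbit_insert_point[OF b T(1) x(2) qT(1), of q] q(3) self_in_orbit[OF b T(1), of q] by simp
  ultimately show "\<exists>a b Y q. unicellular S a b Y \<and> ctype S a = add_mset (Suc l) \<mu> \<and>
    ctype S b = add_mset (Suc m) \<nu> \<and> card S = card Y + Suc k \<and> q \<in> Y \<and>
    card (orbit a (b q)) = Suc l \<and> card (orbit b q) = Suc m"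
    using q(1) by blast
qed

lemma card_eq_SucSucE:
  assumes "finite S" "card S = Suc (Suc n)"
  obtains x y T where "S = insert y (insert x T)" "x \<notin> T" "y \<notin> T" "x \<noteq> y" "finite T" "card T = n"
proof -
  obtain y T' where "S = insert y T'" "y \<notin> T'" "finite T'" "card T' = Suc n"
    using card_eq_SucE[OF assms] .
  moreover from this obtain x T where "T' = insert x T" "x \<notin> T" "finite T" "card T = n"
    using card_eq_SucE[of T' n] by blast
  ultimately show ?thesis using that[of y x T] by blast
qed

text \<open>
  Two edges x and y are added at a common black vertex of degree l. Their white ends are at arbitrary
  points q1 and q2 of the large face; the choice of the same or of two different white vertices is
  left to the two lemmas that follow.
\<close>

lemma realizable_pair:
  assumes "finite S" "card S = Suc (Suc (l + sum_mset \<mu>))"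
    and "realizable (add_mset l \<mu>) \<nu>' k"
  obtains y x T b Y where "S = insert y (insert x T)" "x \<notin> T" "y \<notin> T" "x \<noteq> y" "finite (T :: nat set)"
    "b permutes T" "ctype T b = \<nu>'" "Y \<subseteq> T" "\<forall>z\<in>T. \<exists>q\<in>Y. orbit b q = orbit b z"
    "\<forall>q1\<in>Y. \<forall>q2\<in>Y. \<exists>a2. unicellular S a2 (b \<circ> tr q1 x \<circ> tr q2 y) (insert y (insert x Y)) \<and>
      ctype S a2 = add_mset (l + 2) \<mu> \<and> card (orbit a2 x) = l + 2"
    "card S = card (insert y (insert x Y)) + k"
proof -
  obtain x y T where S: "S = insert y (insert x T)" and xy: "x \<notin> T" "y \<notin> T" "x \<noteq> y"
    and T: "finite T" "card T = l + sum_mset \<mu>"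
    using card_eq_SucSucE[OF assms(1,2)] .
  obtain a b Y where U: "unicellular T a b Y" and ct: "ctype T a = add_mset l \<mu>" "ctype T b = \<nu>'"
    and k: "card T = card Y + k" using assms(3) T unfolding realizable_def by auto
  have a: "a permutes T" and b: "b permutes T" and Y: "Y \<subseteq> T" using U by (auto simp: unicellular_def)
  obtain z where z: "z \<in> T" "card (orbit a z) = l" using ctype_add_msetE[OF T(1) ct(1)] .
  obtain u where u: "u \<in> Y" "b u \<in> T" "orbit a (b u) = orbit a z" using orbit_rep_a[OF U T(1) z(1)] .
  have fin: "finite (insert x T)" "y \<notin> insert x T" using T xy by auto
  let ?a1 = "a \<circ> tr (b u) x"
  have a1: "?a1 permutes insert x T" by (rule permutes_insert_point[OF a u(2)])
  have ct1: "ctype (insert x T) ?a1 = add_mset (Suc l) \<mu>"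
    using ctype_insert_point[OF a T(1) xy(1) u(2)] ct(1) u(3) z(2) by simp
  have l1: "card (orbit ?a1 w) = Suc l" if "w \<in> {b u, x}" for w
    using card_orbit_insert_point[OF a T(1) xy(1) u(2), of w] that u(3) z(2)
      self_in_orbit[OF a T(1), of "b u"] by auto
  show ?thesis
  proof (rule that[OF S xy T(1) b ct(2) Y])
    show "\<forall>z\<in>T. \<exists>q\<in>Y. orbit b q = orbit b z" using orbit_rep_b[OF U T(1)] by metis
    show "card S = card (insert y (insert x Y)) + k"
      using k S xy T Y finite_subset[OF Y T(1)] by (auto simp: card_insert_if)
    show "\<forall>q1\<in>Y. \<forall>q2\<in>Y. \<exists>a2. unicellular S a2 (b \<circ> tr q1 x \<circ> tr q2 y) (insert y (insert x Y)) \<and>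
      ctype S a2 = add_mset (l + 2) \<mu> \<and> card (orbit a2 x) = l + 2"
    proof (intro ballI)
      fix q1 q2 assume q: "q1 \<in> Y" "q2 \<in> Y"
      obtain r where r: "r \<in> {b u, x}"
        and U2: "unicellular S (?a1 \<circ> tr r y) (b \<circ> tr q1 x \<circ> tr q2 y) (insert y (insert x Y))"
        using unicellular_pair[OF U T(1) xy u(1) q] unfolding S .
      have rT: "r \<in> insert x T" using r u(2) by auto
      have "ctype S (?a1 \<circ> tr r y) = add_mset (l + 2) \<mu>"
        unfolding S using ctype_insert_point[OF a1 fin rT] ct1 l1[OF r] by simp
      moreover have "x \<in> orbit ?a1 r"
        using r orbit_insert_point[OF a T(1) xy(1) u(2), of r] self_in_orbit[OF a T(1), of "b u"] by auto
      then have "card (orbit (?a1 \<circ> tr r y) x) = l + 2"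
        using card_orbit_insert_point[OF a1 fin rT, of x] l1[OF r] by simp
      ultimately show "\<exists>a2. unicellular S a2 (b \<circ> tr q1 x \<circ> tr q2 y) (insert y (insert x Y)) \<and>
        ctype S a2 = add_mset (l + 2) \<mu> \<and> card (orbit a2 x) = l + 2" using U2 by blast
    qed
  qed
qed

lemma realizable_pair_same:
  assumes "realizable (add_mset l \<mu>) (add_mset m \<nu>) k"
  shows "realizable_edge (l + 2) (m + 2) \<mu> \<nu> k"
  unfolding realizable_edge_def
proof (intro allI impI)
  fix S :: "nat set" assume fin_S: "finite S" and "card S = l + 2 + sum_mset \<mu>"
  then have card_S: "card S = Suc (Suc (l + sum_mset \<mu>))" by simp
  obtain b x y T Y where S: "S = insert y (insert x T)" and xy: "x \<notin> T" "y \<notin> T" "x \<noteq> y"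
    and T: "finite T" and b: "b permutes T" "ctype T b = add_mset m \<nu>" and Y: "Y \<subseteq> T"
    and rep: "\<forall>z\<in>T. \<exists>q\<in>Y. orbit b q = orbit b z"
    and pair: "\<forall>q1\<in>Y. \<forall>q2\<in>Y. \<exists>a2. unicellular S a2 (b \<circ> tr q1 x \<circ> tr q2 y) (insert y (insert x Y)) \<and>
      ctype S a2 = add_mset (l + 2) \<mu> \<and> card (orbit a2 x) = l + 2"
    and k: "card S = card (insert y (insert x Y)) + k"
    using realizable_pair[OF fin_S card_S assms] .
  obtain z where z: "z \<in> T" "card (orbit b z) = m" using ctype_add_msetE[OF T b(2)] .
  then obtain q where q: "q \<in> Y" "orbit b q = orbit b z" using rep by blast
  have qT: "q \<in> T" using q(1) Y by blast
  let ?b1 = "b \<circ> tr q x" let ?b2 = "?b1 \<circ> tr q y"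
  obtain a2 where a2: "unicellular S a2 ?b2 (insert y (insert x Y))"
      "ctype S a2 = add_mset (l + 2) \<mu>" "card (orbit a2 x) = l + 2" using pair q(1) by blast
  have b1: "?b1 permutes insert x T" by (rule permutes_insert_point[OF b(1) qT])
  have fin: "finite (insert x T)" "y \<notin> insert x T" using T xy by auto
  have c1: "card (orbit ?b1 q) = Suc m"
    using card_orbit_insert_point[OF b(1) T xy(1) qT, of q] q z self_in_orbit[OF b(1) T, of q] by simp
  have ct1: "ctype (insert x T) ?b1 = add_mset (Suc m) \<nu>"
    using ctype_insert_point[OF b(1) T xy(1) qT] b(2) q z by simp
  have "ctype S ?b2 = add_mset (m + 2) \<nu>"
    unfolding S using ctype_insert_point[OF b1 fin, of q] qT ct1 c1 by simp
  moreover have "?b2 y = x" using permutes_not_in[OF b(1) xy(1)] by simp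
  moreover have "card (orbit ?b2 y) = m + 2"
    using card_orbit_insert_point[OF b1 fin, of q y] qT c1 by simp
  ultimately show "\<exists>a b Y q. unicellular S a b Y \<and> ctype S a = add_mset (l + 2) \<mu> \<and>
    ctype S b = add_mset (m + 2) \<nu> \<and> card S = card Y + k \<and> q \<in> Y \<and>
    card (orbit a (b q)) = l + 2 \<and> card (orbit b q) = m + 2"
    using a2 k by (intro exI[of _ a2] exI[of _ ?b2] exI[of _ "insert y (insert x Y)"] exI[of _ y]) simp
qed

lemma realizable_pair_distinct:
  assumes "realizable (add_mset l \<mu>) (add_mset m\<^sub>1 (add_mset m\<^sub>2 \<nu>)) k"
  shows "realizable_edge (l + 2) (Suc m\<^sub>1) \<mu> (add_mset (Suc m\<^sub>2) \<nu>) k"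
  unfolding realizable_edge_def
proof (intro allI impI)
  fix S :: "nat set" assume fin_S: "finite S" and "card S = l + 2 + sum_mset \<mu>"
  then have card_S: "card S = Suc (Suc (l + sum_mset \<mu>))" by simp
  obtain b x y T Y where S: "S = insert y (insert x T)" and xy: "x \<notin> T" "y \<notin> T" "x \<noteq> y"
    and T: "finite T" and b: "b permutes T" "ctype T b = add_mset m\<^sub>1 (add_mset m\<^sub>2 \<nu>)" and Y: "Y \<subseteq> T"
    and rep: "\<forall>z\<in>T. \<exists>q\<in>Y. orbit b q = orbit b z"
    and pair: "\<forall>q1\<in>Y. \<forall>q2\<in>Y. \<exists>a2. unicellular S a2 (b \<circ> tr q1 x \<circ> tr q2 y) (insert y (insert x Y)) \<and>
      ctype S a2 = add_mset (l + 2) \<mu> \<and> card (orbit a2 x) = l + 2"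
    and k: "card S = card (insert y (insert x Y)) + k"
    using realizable_pair[OF fin_S card_S assms] .
  obtain z1 z2 where z: "z1 \<in> T" "card (orbit b z1) = m\<^sub>1" "z2 \<in> T" "card (orbit b z2) = m\<^sub>2" "z2 \<notin> orbit b z1"
    using ctype_add_mset2E[OF b(1) T b(2)] .
  then obtain q1 q2 where q: "q1 \<in> Y" "orbit b q1 = orbit b z1" "q2 \<in> Y" "orbit b q2 = orbit b z2"
    using rep by metis
  have qT: "q1 \<in> T" "q2 \<in> T" using q Y by auto
  have nq: "q2 \<notin> orbit b q1" using q z orbit_eq_if_mem[OF b(1) T, of q2 q1] self_in_orbit[OF b(1) T, of z2] by auto
  have q12: "q1 \<noteq> q2" using nq self_in_orbit[OF b(1) T, of q1] by auto
  let ?b1 = "b \<circ> tr q1 x" let ?b2 = "?b1 \<circ> tr q2 y"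
  obtain a2 where a2: "unicellular S a2 ?b2 (insert y (insert x Y))"
      "ctype S a2 = add_mset (l + 2) \<mu>" "card (orbit a2 x) = l + 2" using pair q(1,3) by blast
  have b1: "?b1 permutes insert x T" by (rule permutes_insert_point[OF b(1) qT(1)])
  have fin: "finite (insert x T)" "y \<notin> insert x T" using T xy by auto
  have o2: "orbit ?b1 q2 = orbit b q2"
    using orbit_insert_point[OF b(1) T xy(1) qT(1), of q2] nq qT(2) xy by auto
  have ct1: "ctype (insert x T) ?b1 = add_mset m\<^sub>2 (add_mset (Suc m\<^sub>1) \<nu>)"
    using ctype_insert_point[OF b(1) T xy(1) qT(1)] b(2) q z by simp
  have "ctype S ?b2 = add_mset (Suc m\<^sub>2) (add_mset (Suc m\<^sub>1) \<nu>)"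
    unfolding S using ctype_insert_point[OF b1 fin, of q2] qT ct1 o2 q z by simp
  then have "ctype S ?b2 = add_mset (Suc m\<^sub>1) (add_mset (Suc m\<^sub>2) \<nu>)" by simp
  moreover have "?b2 q1 = x" using permutes_not_in[OF b(1) xy(1)] q12 qT xy by (auto simp: Transposition.transpose_def)
  moreover have "q2 \<notin> orbit ?b1 q1"
    using orbit_insert_point[OF b(1) T xy(1) qT(1), of q1] nq self_in_orbit[OF b(1) T, of q1] qT xy by auto
  then have "q1 \<notin> orbit ?b1 q2" using orbit_mem_sym[OF b1 fin(1), of q1 q2] by blast
  then have "orbit ?b2 q1 = orbit ?b1 q1"
    using orbit_insert_point[OF b1 fin, of q2 q1] qT xy by auto
  then have "card (orbit ?b2 q1) = Suc m\<^sub>1"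
    using card_orbit_insert_point[OF b(1) T xy(1) qT(1), of q1] q z self_in_orbit[OF b(1) T, of q1] by simp
  ultimately show "\<exists>a b Y q. unicellular S a b Y \<and> ctype S a = add_mset (l + 2) \<mu> \<and>
    ctype S b = add_mset (Suc m\<^sub>1) (add_mset (Suc m\<^sub>2) \<nu>) \<and> card S = card Y + k \<and> q \<in> Y \<and>
    card (orbit a (b q)) = l + 2 \<and> card (orbit b q) = Suc m\<^sub>1"
    using a2 k q(1) by (intro exI[of _ a2] exI[of _ ?b2] exI[of _ "insert y (insert x Y)"] exI[of _ q1]) simp
qed

lemma ctype_inv: "f permutes S \<Longrightarrow> finite S \<Longrightarrow> ctype S (inv' f) = ctype S f"
  by (simp add: ctype_def orbs_inv)

text \<open>Inverting the product exchanges the black and the white vertices.\<close>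

lemma unicellular_swap:
  assumes U: "unicellular S a b Y" and S: "finite S"
  shows "unicellular S (inv' b) (inv' a) Y"
proof -
  have a: "a permutes S" and b: "b permutes S" and Y: "Y \<subseteq> S" and C: "(a \<circ> b) permutes Y"
    using U by (auto simp: unicellular_def single_cycle_def)
  have inv: "inv' b \<circ> inv' a = inv' (a \<circ> b)"
    by (rule o_inv_distrib[OF permutes_bij[OF a] permutes_bij[OF b], symmetric])
  have "single_cycle Y (inv' b \<circ> inv' a)"
    unfolding inv single_cycle_def
    using permutes_inv[OF C] orbit_inv_eq[OF permutation_if_permutes[OF C finite_subset[OF Y S]]] U
    by (auto simp: unicellular_def single_cycle_def)
  then show ?thesis unfolding unicellular_def
    using permutes_inv[OF a] permutes_inv[OF b] Y U orbit_inv_eq[OF permutation_if_permutes[OF a S]]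
      orbit_inv_eq[OF permutation_if_permutes[OF b S]] by (auto simp: unicellular_def)
qed

lemma realizable_swap:
  assumes R: "realizable \<mu> \<nu> k" and sum: "sum_mset \<mu> = sum_mset \<nu>" shows "realizable \<nu> \<mu> k"
  unfolding realizable_def
proof (intro allI impI)
  fix S :: "nat set" assume S: "finite S" "card S = sum_mset \<nu>"
  then obtain a b Y where U: "unicellular S a b Y" "ctype S a = \<mu>" "ctype S b = \<nu>" "card S = card Y + k"
    using R sum unfolding realizable_def by metis
  have "a permutes S" "b permutes S" using U(1) by (auto simp: unicellular_def)
  then show "\<exists>a b Y. unicellular S a b Y \<and> ctype S a = \<nu> \<and> ctype S b = \<mu> \<and> card S = card Y + k"
    using unicellular_swap[OF U(1) S(1)] U ctype_inv[OF _ S(1)]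
    by (intro exI[of _ "inv' b"] exI[of _ "inv' a"] exI[of _ Y] conjI) simp_all
qed

lemma ctype_conj:
  assumes "b permutes S" "h permutes S" "finite S"
  shows "ctype S (h \<circ> b \<circ> inv' h) = ctype S b"
proof -
  have "card (h ` V) = card V" for V by (rule card_image) (rule inj_on_subset[OF permutes_inj[OF assms(2)]], simp)
  moreover have "inj_on (\<lambda>V. h ` V) (orbs S b)"
    by (intro inj_onI) (simp add: inj_image_eq_iff[OF permutes_inj[OF assms(2)]])
  then have "mset_set ((\<lambda>V. h ` V) ` orbs S b) = image_mset (\<lambda>V. h ` V) (mset_set (orbs S b))"
    by (simp add: image_mset_mset_set)
  ultimately show ?thesis unfolding ctype_def orbs_conj[OF assms] by (simp add: image_mset.compositionality comp_def)
qed

lemma realizable_0: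
  assumes sum: "sum_mset \<mu> = n" "sum_mset \<nu> = n" and pos: "0 \<notin># \<mu>" "0 \<notin># \<nu>"
    and less: "size \<mu> + size \<nu> < n" and parity: "odd (n + size \<mu> + size \<nu>)"
  shows "realizable \<mu> \<nu> 0"
  unfolding realizable_def
proof (intro allI impI)
  fix S :: "nat set" assume S: "finite S" "card S = sum_mset \<mu>"
  obtain a where a: "a permutes S" "ctype S a = \<mu>" using exists_ctype[OF pos(1) S] by blast
  obtain b where b: "b permutes S" "ctype S b = \<nu>"
    using exists_ctype[OF pos(2) S(1)] S sum by metis
  have cards: "card (orbs S a) = size \<mu>" "card (orbs S b) = size \<nu>" "card S = n"
    using a b S sum by (auto simp: size_ctype[symmetric])
  obtain h where h: "h permutes S" "orbs S (a \<circ> (h \<circ> b \<circ> inv' h)) = {S}"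
    by (rule exists_conj_one_cycle[OF a(1) b(1) S(1)]) (use cards less parity in \<open>auto simp: ac_simps\<close>)
  let ?b = "h \<circ> b \<circ> inv' h"
  have b': "?b permutes S" by (rule permutes_conj[OF b(1) h(1)])
  have "a \<circ> ?b permutes S" by (rule permutes_compose[OF b' a(1)])
  moreover have "\<forall>z\<in>S. orbit (a \<circ> ?b) z = S" using h(2) orbs_mem[of _ S "a \<circ> ?b"] by blast
  ultimately have "single_cycle S (a \<circ> ?b)" by (simp add: single_cycle_def)
  then have "unicellular S a ?b S"
    using a(1) b' self_in_orbit[OF a(1) S(1)] self_in_orbit[OF b' S(1)] unfolding unicellular_def by blast
  then show "\<exists>a b Y. unicellular S a b Y \<and> ctype S a = \<mu> \<and> ctype S b = \<nu> \<and> card S = card Y + 0"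
    using a(2) b(2) ctype_conj[OF b(1) h(1) S(1)]
    by (intro exI[of _ a] exI[of _ ?b] exI[of _ S]) simp
qed

lemma sum_mset_le_size:
  fixes M :: "nat multiset"
  assumes "\<And>x. x \<in># M \<Longrightarrow> x \<le> c" shows "sum_mset M \<le> c * size M"
  using assms by (induction M) (auto intro!: add_mono)

lemma sum_mset_ones_threes:
  fixes M :: "nat multiset"
  assumes "\<And>x. x \<in># M \<Longrightarrow> x = 1 \<or> x = 3" shows "sum_mset M = size M + 2 * count M 3"
  using assms
proof (induction M)
  case (add x M)
  then have "sum_mset M = size M + 2 * count M 3" "x = 1 \<or> x = 3" by auto
  then show ?case by auto
qed simp

lemma obtain_two_threes:
  fixes M :: "nat multiset"
  assumes "0 \<notin># M" "2 \<notin># M" "\<And>x. x \<in># M \<Longrightarrow> x < 4" "size M + 3 \<le> sum_mset M"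
  obtains M' where "M = add_mset 3 (add_mset 3 M')"
proof -
  have "x = 1 \<or> x = 3" if "x \<in># M" for x
  proof -
    have "x < 4" "x \<noteq> 0" "x \<noteq> 2" using assms(1-3) that by metis+
    then show ?thesis by auto
  qed
  then have "sum_mset M = size M + 2 * count M 3" by (rule sum_mset_ones_threes)
  then have "2 \<le> count M 3" using assms(4) by simp
  then have "replicate_mset 2 3 \<subseteq># M" by (simp add: count_le_replicate_mset_subset_eq)
  then obtain M' where "M = replicate_mset 2 3 + M'" by (auto simp: mset_subset_eq_exists_conv)
  then have "M = add_mset 3 (add_mset 3 M')" by (simp add: numeral_2_eq_2)
  then show ?thesis by (rule that)
qed

text \<open>
  The step from k to k + 1 removes up to four points from both permutations, so that the hypotheses
  hold for k and the rest, and puts them back with one more fixed point in the product. There are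
  four cases: a cycle of length 2 against one of length at least 3 (a new vertex whose only edge is
  doubled); two cycles of length at least 4 (two edges joining them, one of which is doubled); a
  cycle of length at least 4 against two cycles of length 3 (two edges to different vertices, one of
  which is doubled); and two cycles of length 3 against two cycles of length 3. If none of them
  applies, then both permutations together have too many cycles.
\<close>

lemma realizable_if_large:
  assumes "sum_mset \<mu> = n" "sum_mset \<nu> = n" "0 \<notin># \<mu>" "0 \<notin># \<nu>"
    and "size \<mu> + size \<nu> + 3 * k + 1 \<le> n" "odd (n + k + size \<mu> + size \<nu>)"
  shows "realizable \<mu> \<nu> k"
  using assms
proof (induction k arbitrary: \<mu> \<nu> n)
  case 0
  then show ?case by (intro realizable_0[of _ n]) auto
next
  case (Suc k)
  have step2: "realizable \<mu> \<nu> (Suc k)"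
    if H: "sum_mset \<mu> = n" "sum_mset \<nu> = n" "0 \<notin># \<mu>" "0 \<notin># \<nu>"
      "size \<mu> + size \<nu> + 3 * Suc k + 1 \<le> n" "odd (n + Suc k + size \<mu> + size \<nu>)"
      and l: "2 \<in># \<mu>" "m \<in># \<nu>" "3 \<le> m" for \<mu> \<nu> m
  proof -
    obtain \<mu>' \<nu>' where eq: "\<mu> = add_mset 2 \<mu>'" "\<nu> = add_mset m \<nu>'" using l by (metis mset_add)
    have "realizable \<mu>' (add_mset (m - 2) \<nu>') k"
      by (rule Suc.IH[of _ "n - 2"]) (use H l eq in auto)
    then have "realizable_edge 1 (Suc (m - 2)) \<mu>' \<nu>' k" by (rule realizable_pendant)
    then have "realizable_edge (Suc 1) (Suc (Suc (m - 2))) \<mu>' \<nu>' (Suc k)"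
      by (rule realizable_edge_duplicate)
    then have "realizable (add_mset (Suc 1) \<mu>') (add_mset (Suc (Suc (m - 2))) \<nu>') (Suc k)"
      by (rule realizable_edge_imp_realizable)
    moreover have "Suc 1 = 2" "Suc (Suc (m - 2)) = m" using l(3) by auto
    ultimately show ?thesis by (simp only: eq)
  qed
  have step4: "realizable \<mu> \<nu> (Suc k)"
    if H: "sum_mset \<mu> = n" "sum_mset \<nu> = n" "0 \<notin># \<mu>" "0 \<notin># \<nu>"
      "size \<mu> + size \<nu> + 3 * Suc k + 1 \<le> n" "odd (n + Suc k + size \<mu> + size \<nu>)"
      and l: "l \<in># \<mu>" "4 \<le> l" and no2: "2 \<notin># \<nu>" for \<mu> \<nu> l
  proof -
    obtain \<mu>' where eq: "\<mu> = add_mset l \<mu>'" using l by (metis mset_add)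
    have step: "realizable (add_mset (l - 3) \<mu>') \<nu>' k"
      if "size \<nu>' = size \<nu>" "sum_mset \<nu>' = n - 3" "0 \<notin># \<nu>'" for \<nu>'
      by (rule Suc.IH[of _ "n - 3"]) (use H l eq that in auto)
    show ?thesis
    proof (cases "\<exists>m\<in>#\<nu>. 4 \<le> m")
      case True
      then obtain m \<nu>' where m: "\<nu> = add_mset m \<nu>'" "4 \<le> m" by (metis mset_add)
      have "realizable (add_mset (l - 3) \<mu>') (add_mset (m - 3) \<nu>') k"
        by (rule step) (use m H in auto)
      then have "realizable_edge (l - 3 + 2) (m - 3 + 2) \<mu>' \<nu>' k" by (rule realizable_pair_same)
      then have "realizable_edge (Suc (l - 3 + 2)) (Suc (m - 3 + 2)) \<mu>' \<nu>' (Suc k)"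
        by (rule realizable_edge_duplicate)
      then have "realizable (add_mset (Suc (l - 3 + 2)) \<mu>') (add_mset (Suc (m - 3 + 2)) \<nu>') (Suc k)"
        by (rule realizable_edge_imp_realizable)
      moreover have "Suc (l - 3 + 2) = l" "Suc (m - 3 + 2) = m" using l(2) m(2) by auto
      ultimately show ?thesis by (simp only: eq m(1))
    next
      case False
      obtain \<nu>' where m: "\<nu> = add_mset 3 (add_mset 3 \<nu>')"
        by (rule obtain_two_threes[OF H(4) no2]) (use False H in auto)
      have "realizable (add_mset (l - 3) \<mu>') (add_mset 1 (add_mset 2 \<nu>')) k"
        by (rule step) (use m H in auto)
      then have "realizable_edge (l - 3 + 2) (Suc 1) \<mu>' (add_mset (Suc 2) \<nu>') k"
        by (rule realizable_pair_distinct)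
      then have "realizable_edge (Suc (l - 3 + 2)) (Suc (Suc 1)) \<mu>' (add_mset (Suc 2) \<nu>') (Suc k)"
        by (rule realizable_edge_duplicate)
      then have "realizable (add_mset (Suc (l - 3 + 2)) \<mu>')
          (add_mset (Suc (Suc 1)) (add_mset (Suc 2) \<nu>')) (Suc k)"
        by (rule realizable_edge_imp_realizable)
      moreover have "Suc (l - 3 + 2) = l" "Suc (Suc 1) = 3" "Suc 2 = 3" using l(2) by auto
      ultimately show ?thesis by (simp only: eq m)
    qed
  qed
  note H = Suc.prems
  have sums: "sum_mset \<nu> = sum_mset \<mu>" using H by simp
  have H': "sum_mset \<nu> = n" "sum_mset \<mu> = n" "0 \<notin># \<nu>" "0 \<notin># \<mu>"
    "size \<nu> + size \<mu> + 3 * Suc k + 1 \<le> n" "odd (n + Suc k + size \<nu> + size \<mu>)"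
    using H by (auto simp: ac_simps)
  consider m where "2 \<in># \<mu>" "m \<in># \<nu>" "3 \<le> m" | l where "2 \<in># \<nu>" "l \<in># \<mu>" "3 \<le> l"
    | "2 \<in># \<mu> \<or> 2 \<in># \<nu>" "\<forall>m\<in>#\<mu>. m \<le> 2" "\<forall>m\<in>#\<nu>. m \<le> 2"
    | "2 \<in># \<mu>" "2 \<notin># \<nu>" "\<forall>m\<in>#\<nu>. m \<le> 2" | "2 \<in># \<nu>" "2 \<notin># \<mu>" "\<forall>m\<in>#\<mu>. m \<le> 2"
    | l where "2 \<notin># \<mu>" "2 \<notin># \<nu>" "l \<in># \<mu>" "4 \<le> l"
    | m where "2 \<notin># \<mu>" "2 \<notin># \<nu>" "m \<in># \<nu>" "4 \<le> m"
    | "2 \<notin># \<mu>" "2 \<notin># \<nu>" "\<forall>m\<in>#\<mu>. m < 4" "\<forall>m\<in>#\<nu>. m < 4"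
    by (cases "2 \<in># \<mu>"; cases "2 \<in># \<nu>"; cases "\<forall>m\<in>#\<mu>. m \<le> 2"; cases "\<forall>m\<in>#\<nu>. m \<le> 2";
        cases "\<forall>m\<in>#\<mu>. m < 4"; cases "\<forall>m\<in>#\<nu>. m < 4") (auto simp: not_le not_less Suc_le_eq eval_nat_numeral)
  then show ?case
  proof cases
    case 1
    then show ?thesis using step2[OF H] by blast
  next
    case 2
    then show ?thesis using realizable_swap[OF step2[OF H'] sums] by blast
  next
    case 3
    then have "n \<le> 2 * size \<mu>" "n \<le> 2 * size \<nu>"
      using sum_mset_le_size[of \<mu> 2] sum_mset_le_size[of \<nu> 2] H by auto
    then show ?thesis using H by simp
  next
    case 4
    then have "x \<le> 1" if "x \<in># \<nu>" for x using that by (metis One_nat_def Suc_1 le_Suc_eq)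
    then have "n \<le> size \<nu>" using sum_mset_le_size[of \<nu> 1] H by auto
    then show ?thesis using H by simp
  next
    case 5
    then have "x \<le> 1" if "x \<in># \<mu>" for x using that by (metis One_nat_def Suc_1 le_Suc_eq)
    then have "n \<le> size \<mu>" using sum_mset_le_size[of \<mu> 1] H by auto
    then show ?thesis using H by simp
  next
    case 6
    then show ?thesis using step4[OF H] by blast
  next
    case 7
    then show ?thesis using realizable_swap[OF step4[OF H'] sums] by blast
  next
    case 8
    obtain \<mu>' where l: "\<mu> = add_mset 3 (add_mset 3 \<mu>')"
      by (rule obtain_two_threes[OF H(3) 8(1)]) (use 8 H in auto)
    obtain \<nu>' where m: "\<nu> = add_mset 3 (add_mset 3 \<nu>')"
      by (rule obtain_two_threes[OF H(4) 8(2)]) (use 8 H in auto)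
    \<comment> \<open>A doubled edge at a new vertex gives the fixed point. It leaves a cycle of length 2, and a pair
      of edges at a common white vertex lengthens this one and another one to length 3.\<close>
    have "realizable (add_mset 2 \<mu>') (add_mset 1 (add_mset 1 \<nu>')) k"
      by (rule Suc.IH[of _ "n - 4"]) (use H l m in auto)
    then have "realizable_edge 1 (Suc 1) (add_mset 2 \<mu>') (add_mset 1 \<nu>') k"
      by (rule realizable_pendant)
    then have "realizable_edge (Suc 1) (Suc (Suc 1)) (add_mset 2 \<mu>') (add_mset 1 \<nu>') (Suc k)"
      by (rule realizable_edge_duplicate)
    then have "realizable (add_mset (Suc 1) (add_mset 2 \<mu>')) (add_mset (Suc (Suc 1)) (add_mset 1 \<nu>')) (Suc k)"
      by (rule realizable_edge_imp_realizable)
    then have "realizable (add_mset 2 (add_mset 2 \<mu>')) (add_mset 3 (add_mset 1 \<nu>')) (Suc k)"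
      by (simp add: numeral_2_eq_2 numeral_3_eq_3)
    then have "realizable (add_mset 1 (add_mset 3 \<nu>')) (add_mset 2 (add_mset 2 \<mu>')) (Suc k)"
      using realizable_swap[of "add_mset 2 (add_mset 2 \<mu>')" "add_mset 3 (add_mset 1 \<nu>')"] H l m
      by (simp add: add_mset_commute)
    then have "realizable_edge (1 + 2) (Suc 2) (add_mset 3 \<nu>') (add_mset (Suc 2) \<mu>') (Suc k)"
      by (rule realizable_pair_distinct)
    then have "realizable (add_mset (1 + 2) (add_mset 3 \<nu>')) (add_mset (Suc 2) (add_mset (Suc 2) \<mu>')) (Suc k)"
      by (rule realizable_edge_imp_realizable)
    then have "realizable \<nu> \<mu> (Suc k)" using l m by (simp add: numeral_3_eq_3)
    then show ?thesis using realizable_swap sums by blast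
  qed
qed

section \<open>Conjugation and centralizers\<close>

text \<open>
  In the induction, x is deleted and the point before x takes over its role as the marked point. The
  mark makes sure that x' is inserted at the corresponding place of the corresponding cycle.
\<close>

lemma conj_if_ctype_eq_marked:
  assumes "finite S" "finite S'" "f permutes S" "g permutes S'" "ctype S f = ctype S' g"
    and "x \<in> S" "x' \<in> S'" "card (orbit f x) = card (orbit g x')"
  shows "\<exists>h. bij_betw h S S' \<and> (\<forall>z\<in>S. h (f z) = g (h z)) \<and> h x = x'"
  using assms
proof (induction "card S" arbitrary: S S' f g x x')
  case 0
  then show ?case by auto
next
  case (Suc n)
  define T T' where "T = S - {x}" and "T' = S' - {x'}"
  have T: "finite T" "x \<notin> T" "S = insert x T" "card T = n" using Suc.prems Suc.hyps(2) by (auto simp: T_def)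
  have T': "finite T'" "x' \<notin> T'" "S' = insert x' T'" using Suc.prems by (auto simp: T'_def)
  have extend: "bij_betw (h(x := x')) S S'" if "bij_betw h T T'" for h
  proof -
    have "bij_betw (h(x := x')) T T'" using that T(2) by (subst bij_betw_cong[of T _ h]) auto
    then show ?thesis unfolding T(3) T'(3) using T(2) T'(2) notIn_Un_bij_betw[of x T "h(x := x')" T'] by simp
  qed
  have fix_iff: "f x = x \<longleftrightarrow> g x' = x'"
    using card_orbit_eq_1_iff[OF Suc.prems(3,1), of x] card_orbit_eq_1_iff[OF Suc.prems(4,2), of x'] Suc.prems(8)
    by simp
  show ?case
  proof (cases "f x = x")
    case True
    then have gx: "g x' = x'" using fix_iff by simp
    have f: "f permutes T" and g: "g permutes T'"
      using Suc.prems(3,4) True gx T T' permutes_if_fixed by metis+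
    have ct: "ctype T f = ctype T' g"
      using Suc.prems(5) unfolding T(3) T'(3) ctype_insert_fixed[OF f T(1,2)] ctype_insert_fixed[OF g T'(1,2)] by simp
    have "\<exists>h. bij_betw h T T' \<and> (\<forall>z\<in>T. h (f z) = g (h z))"
    proof (cases "T = {}")
      case True
      then have "card T' = 0"
        using sum_ctype[OF f T(1)] sum_ctype[OF g T'(1)] ct by (metis card.empty)
      then have "T' = {}" using T'(1) by simp
      then show ?thesis using True by (auto simp: bij_betw_def)
    next
      case False
      then obtain y where y: "y \<in> T" by blast
      obtain M where "ctype T' g = add_mset (card (orbit f y)) M"
        using ctype_remove_orbit[OF T(1) y, of f] ct by metis
      then obtain y' where "y' \<in> T'" "card (orbit g y') = card (orbit f y)" by (rule ctype_add_msetE[OF T'(1)])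
      then show ?thesis using Suc.hyps(1)[OF T(4)[symmetric] T(1) T'(1) f g ct y] by metis
    qed
    then obtain h where h: "bij_betw h T T'" "\<And>z. z \<in> T \<Longrightarrow> h (f z) = g (h z)" by blast
    have "f z \<noteq> x" if "z \<in> T" for z using permutes_in_image[OF f] that T(2) by metis
    then have "\<forall>z\<in>S. (h(x := x')) (f z) = g ((h(x := x')) z)" using h(2) True gx T(2) unfolding T(3) by auto
    then show ?thesis using extend[OF h(1)] by (intro exI[of _ "h(x := x')"]) simp
  next
    case False
    then have gx: "g x' \<noteq> x'" using fix_iff by simp
    obtain f0 r where f0: "f0 permutes T" "r \<in> T" "f = f0 \<circ> tr r x" "f r = x"
      using remove_point[of f x T] Suc.prems(3) T False by metis
    obtain g0 r' where g0: "g0 permutes T'" "r' \<in> T'" "g = g0 \<circ> tr r' x'" "g r' = x'"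
      using remove_point[of g x' T'] Suc.prems(4) T' gx by metis
    obtain M where M: "ctype T f0 = add_mset (card (orbit f0 r)) M" using ctype_remove_orbit[OF T(1) f0(2)] by metis
    obtain M' where M': "ctype T' g0 = add_mset (card (orbit g0 r')) M'" using ctype_remove_orbit[OF T'(1) g0(2)] by metis
    have "card (orbit f x) = Suc (card (orbit f0 r))"
      unfolding f0(3) by (rule card_orbit_insert_point[OF f0(1) T(1,2) f0(2)]) simp
    moreover have "card (orbit g x') = Suc (card (orbit g0 r'))"
      unfolding g0(3) by (rule card_orbit_insert_point[OF g0(1) T'(1,2) g0(2)]) simp
    ultimately have l: "card (orbit f0 r) = card (orbit g0 r')" using Suc.prems(8) by simp
    have "ctype S f = add_mset (Suc (card (orbit f0 r))) M"
      unfolding T(3) f0(3) by (rule ctype_insert_point[OF f0(1) T(1,2) f0(2) M])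
    moreover have "ctype S' g = add_mset (Suc (card (orbit g0 r'))) M'"
      unfolding T'(3) g0(3) by (rule ctype_insert_point[OF g0(1) T'(1,2) g0(2) M'])
    ultimately have "ctype T f0 = ctype T' g0" using Suc.prems(5) l M M' by simp
    then obtain h where h: "bij_betw h T T'" "\<And>z. z \<in> T \<Longrightarrow> h (f0 z) = g0 (h z)" "h r = r'"
      using Suc.hyps(1)[OF T(4)[symmetric] T(1) T'(1) f0(1) g0(1) _ f0(2) g0(2) l] by blast
    define k where "k = h(x := x')"
    have kT: "k z = h z" if "z \<in> T" for z using that T(2) by (auto simp: k_def)
    have "k (f z) = g (k z)" if "z \<in> S" for z
    proof -
      consider "z = x" | "z = r" | "z \<in> T" "z \<noteq> r" using \<open>z \<in> S\<close> T(3) by blast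
      then show ?thesis
      proof cases
        case 1
        have "f0 r \<in> T" using permutes_in_image[OF f0(1)] f0(2) by simp
        then show ?thesis using 1 kT[of "f0 r"] h(2)[OF f0(2)] h(3) f0(3) g0(3) by (simp add: k_def)
      next
        case 2
        then show ?thesis using f0(4) g0(4) kT[OF f0(2)] h(3) by (simp add: k_def)
      next
        case 3
        have "h z \<in> T'" "h z \<noteq> r'"
          using h(1,3) 3 f0(2) by (auto simp: bij_betw_def inj_on_def)
        moreover have "f0 z \<in> T" using permutes_in_image[OF f0(1)] 3 by simp
        moreover have "z \<noteq> x" using 3(1) T(2) by auto
        ultimately show ?thesis using 3 kT[of z] kT[of "f0 z"] h(2)[of z] T'(2) f0(3) g0(3)
          by (auto simp: Transposition.transpose_def)
      qed
    qed
    then show ?thesis using extend[OF h(1)] unfolding k_def by (intro exI[of _ "h(x := x')"]) simp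
  qed
qed

lemma conj_if_ctype_eq:
  assumes S: "finite S" and f: "f permutes S" and g: "g permutes S" and ct: "ctype S f = ctype S g"
  obtains h where "h permutes S" "h \<circ> f \<circ> inv' h = g"
proof (cases "S = {}")
  case True
  then show ?thesis using that[of id] f g by simp
next
  case False
  then obtain x where x: "x \<in> S" by blast
  obtain M where "ctype S g = add_mset (card (orbit f x)) M"
    using ctype_remove_orbit[OF S x, of f] ct by metis
  then obtain x' where "x' \<in> S" "card (orbit g x') = card (orbit f x)" by (rule ctype_add_msetE[OF S])
  then obtain k where k: "bij_betw k S S" "\<And>z. z \<in> S \<Longrightarrow> k (f z) = g (k z)"
    using conj_if_ctype_eq_marked[OF S S f g ct x] by metis
  define h where "h z = (if z \<in> S then k z else z)" for z
  have h: "h permutes S"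
    by (rule bij_imp_permutes) (use k(1) bij_betw_cong[of S h k] in \<open>auto simp: h_def\<close>)
  have "h (f z) = g (h z)" for z
    using k(2)[of z] permutes_in_image[OF f, of z] permutes_not_in[OF f, of z] permutes_not_in[OF g, of z]
    by (auto simp: h_def)
  then have "h \<circ> f = g \<circ> h" by (simp add: fun_eq_iff)
  then have "h \<circ> f \<circ> inv' h = g" using permutes_inv_o(1)[OF h] by (metis comp_assoc comp_id)
  then show ?thesis using h by (rule that[rotated])
qed

text \<open>
  Two cycles of the same length l can be exchanged by a product of l disjoint transpositions. The
  induction deletes one point of each cycle.
\<close>

lemma swap_equal_orbits:
  assumes "finite S" "a permutes S" "x\<^sub>1 \<in> S" "x\<^sub>2 \<in> S" "x\<^sub>2 \<notin> orbit a x\<^sub>1"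
    "card (orbit a x\<^sub>1) = l" "card (orbit a x\<^sub>2) = l"
  shows "\<exists>\<sigma>. \<sigma> permutes S \<and> \<sigma> \<circ> a = a \<circ> \<sigma> \<and> \<sigma> x\<^sub>1 = x\<^sub>2 \<and> \<sigma> x\<^sub>2 = x\<^sub>1 \<and> (evenperm \<sigma> \<longleftrightarrow> even l)"
  using assms
proof (induction l arbitrary: S a x\<^sub>1 x\<^sub>2)
  case 0
  then show ?case using finite_subset[OF orbit_subset_carrier[OF 0(2,3)] 0(1)] orbit_nonempty[of a x\<^sub>1] by simp
next
  case (Suc l)
  note S = Suc.prems(1) and a = Suc.prems(2)
  note self = self_in_orbit[OF a S]
  have x12: "x\<^sub>1 \<noteq> x\<^sub>2" using Suc.prems(5) self by auto
  show ?case
  proof (cases "l = 0")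
    case True
    have ax: "a x\<^sub>1 = x\<^sub>1" "a x\<^sub>2 = x\<^sub>2"
      using Suc.prems(6,7) True card_orbit_eq_1_iff[OF a S] by simp_all
    have "tr x\<^sub>1 x\<^sub>2 (a z) = a (tr x\<^sub>1 x\<^sub>2 z)" for z
      using ax injD[OF permutes_inj[OF a], of z x\<^sub>1] injD[OF permutes_inj[OF a], of z x\<^sub>2]
      by (auto simp: Transposition.transpose_def)
    then show ?thesis using True x12 Suc.prems(3,4)
      by (intro exI[of _ "tr x\<^sub>1 x\<^sub>2"]) (auto simp: fun_eq_iff permutes_swap_id evenperm_swap)
  next
    case False
    define T2 where "T2 = S - {x\<^sub>2}"
    define T where "T = T2 - {x\<^sub>1}"
    have T2: "finite T2" "x\<^sub>2 \<notin> T2" "S = insert x\<^sub>2 T2" "x\<^sub>1 \<in> T2" using S Suc.prems(3,4) x12 by (auto simp: T2_def)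
    have T: "finite T" "x\<^sub>1 \<notin> T" "T2 = insert x\<^sub>1 T" "x\<^sub>2 \<notin> T" using T2 by (auto simp: T_def)
    have "a x\<^sub>2 \<noteq> x\<^sub>2" using Suc.prems(7) False orbit_fixpoint[of a x\<^sub>2] by auto
    then obtain a1 r\<^sub>2 where a1: "a1 permutes T2" "r\<^sub>2 \<in> T2" "a = a1 \<circ> tr r\<^sub>2 x\<^sub>2"
      using remove_point[of a x\<^sub>2 T2] a T2 by metis
    have orb1: "orbit a z = (if z \<in> insert x\<^sub>2 (orbit a1 r\<^sub>2) then insert x\<^sub>2 (orbit a1 r\<^sub>2) else orbit a1 z)" for z
      unfolding a1(3) by (rule orbit_insert_point[OF a1(1) T2(1,2) a1(2)])
    have "orbit a x\<^sub>2 = insert x\<^sub>2 (orbit a1 r\<^sub>2)" using orb1[of x\<^sub>2] by simp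
    moreover have "x\<^sub>1 \<notin> orbit a x\<^sub>2" using Suc.prems(5) orbit_mem_sym[OF a S, of x\<^sub>1 x\<^sub>2] by blast
    ultimately have n1: "x\<^sub>1 \<notin> orbit a1 r\<^sub>2" "orbit a x\<^sub>1 = orbit a1 x\<^sub>1" using orb1[of x\<^sub>1] x12 by auto
    have l2: "card (orbit a1 r\<^sub>2) = l"
      using card_orbit_insert_point[OF a1(1) T2(1,2) a1(2), of x\<^sub>2, folded a1(3)] Suc.prems(7) by simp
    have "a1 x\<^sub>1 \<noteq> x\<^sub>1" using Suc.prems(6) False n1(2) orbit_fixpoint[of a1 x\<^sub>1] by auto
    then obtain a0 r\<^sub>1 where a0: "a0 permutes T" "r\<^sub>1 \<in> T" "a1 = a0 \<circ> tr r\<^sub>1 x\<^sub>1"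
      using remove_point[of a1 x\<^sub>1 T] a1(1) T by metis
    have orb0: "orbit a1 z = (if z \<in> insert x\<^sub>1 (orbit a0 r\<^sub>1) then insert x\<^sub>1 (orbit a0 r\<^sub>1) else orbit a0 z)" for z
      unfolding a0(3) by (rule orbit_insert_point[OF a0(1) T(1,2) a0(2)])
    have l1: "card (orbit a0 r\<^sub>1) = l"
      using card_orbit_insert_point[OF a0(1) T(1,2) a0(2), of x\<^sub>1] Suc.prems(6) a0(3) n1(2) by simp
    have r2n: "r\<^sub>2 \<notin> insert x\<^sub>1 (orbit a0 r\<^sub>1)"
      using orb0[of r\<^sub>2] n1(1) by (auto split: if_splits)
    then have r2: "r\<^sub>2 \<in> T" "r\<^sub>2 \<notin> orbit a0 r\<^sub>1" "card (orbit a0 r\<^sub>2) = l"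
      using a1(2) T(3) orb0[of r\<^sub>2] l2 by auto
    obtain \<sigma> where \<sigma>: "\<sigma> permutes T" "\<sigma> \<circ> a0 = a0 \<circ> \<sigma>" "\<sigma> r\<^sub>1 = r\<^sub>2" "\<sigma> r\<^sub>2 = r\<^sub>1" "evenperm \<sigma> \<longleftrightarrow> even l"
      using Suc.IH[OF T(1) a0(1,2) r2(1,2) l1 r2(3)] by blast
    have comm: "\<sigma> (a0 z) = a0 (\<sigma> z)" for z using \<sigma>(2) by (metis comp_apply)
    have fixed: "\<sigma> x\<^sub>1 = x\<^sub>1" "\<sigma> x\<^sub>2 = x\<^sub>2" "a0 x\<^sub>1 = x\<^sub>1" "a0 x\<^sub>2 = x\<^sub>2"
      using permutes_not_in[OF \<sigma>(1)] permutes_not_in[OF a0(1)] T by auto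
    have inj: "\<sigma> z = \<sigma> w \<longleftrightarrow> z = w" "a0 z = a0 w \<longleftrightarrow> z = w" for z w
      using permutes_inj[OF \<sigma>(1)] permutes_inj[OF a0(1)] by (auto dest: injD)
    have neq: "r\<^sub>1 \<noteq> x\<^sub>1" "r\<^sub>1 \<noteq> x\<^sub>2" "r\<^sub>2 \<noteq> x\<^sub>1" "r\<^sub>2 \<noteq> x\<^sub>2" "r\<^sub>1 \<noteq> r\<^sub>2"
      using a0(2) r2 T T2 self_in_orbit[OF a0(1) T(1), of r\<^sub>1] by auto
    define \<rho> where "\<rho> = \<sigma> \<circ> tr x\<^sub>1 x\<^sub>2"
    have a_eq: "a z = (if z = x\<^sub>1 then a0 r\<^sub>1 else if z = r\<^sub>1 then x\<^sub>1 else if z = x\<^sub>2 then a0 r\<^sub>2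
        else if z = r\<^sub>2 then x\<^sub>2 else a0 z)" for z
      using neq x12 fixed unfolding a1(3) a0(3) by (auto simp: Transposition.transpose_def)
    have \<rho>_eq: "\<rho> z = (if z = x\<^sub>1 then x\<^sub>2 else if z = x\<^sub>2 then x\<^sub>1 else \<sigma> z)" for z
      using fixed by (auto simp: \<rho>_def Transposition.transpose_def)
    have img: "\<sigma> z = x\<^sub>1 \<longleftrightarrow> z = x\<^sub>1" "\<sigma> z = x\<^sub>2 \<longleftrightarrow> z = x\<^sub>2" "\<sigma> z = r\<^sub>1 \<longleftrightarrow> z = r\<^sub>2" "\<sigma> z = r\<^sub>2 \<longleftrightarrow> z = r\<^sub>1"
      "a0 z = x\<^sub>1 \<longleftrightarrow> z = x\<^sub>1" "a0 z = x\<^sub>2 \<longleftrightarrow> z = x\<^sub>2" for z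
      using inj(1)[of z x\<^sub>1] inj(1)[of z x\<^sub>2] inj(1)[of z r\<^sub>1] inj(1)[of z r\<^sub>2] inj(2)[of z x\<^sub>1]
        inj(2)[of z x\<^sub>2] fixed \<sigma>(3,4) by auto
    have "\<rho> (a z) = a (\<rho> z)" for z
      using neq x12 unfolding a_eq \<rho>_eq by (simp add: img comm \<sigma>(3,4))
    moreover have "\<rho> permutes S"
    proof -
      have "\<sigma> permutes S" by (rule permutes_subset[OF \<sigma>(1)]) (use T T2 in auto)
      then show ?thesis unfolding \<rho>_def by (rule permutes_comp_tr) (use Suc.prems in auto)
    qed
    moreover have "evenperm \<rho> \<longleftrightarrow> even (Suc l)"
      unfolding \<rho>_def evenperm_comp_tr[OF \<sigma>(1) T(1) x12] using \<sigma>(5) by simp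
    moreover have "\<rho> x\<^sub>1 = x\<^sub>2" "\<rho> x\<^sub>2 = x\<^sub>1" using \<rho>_eq by simp_all
    ultimately show ?thesis by (intro exI[of _ \<rho>]) (simp add: fun_eq_iff)
  qed
qed

text \<open>
  If the common length is odd, exchange the two cycles; if it is even, a single cycle is odd.
\<close>

lemma odd_centralizer_if_equal_orbits:
  assumes S: "finite S" and a: "a permutes S" and x: "x\<^sub>1 \<in> S" "x\<^sub>2 \<in> S" "x\<^sub>2 \<notin> orbit a x\<^sub>1"
    and l: "card (orbit a x\<^sub>1) = card (orbit a x\<^sub>2)"
  obtains \<sigma> where "\<sigma> permutes S" "\<not> evenperm \<sigma>" "\<sigma> \<circ> a = a \<circ> \<sigma>"
proof (cases "even (card (orbit a x\<^sub>1))")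
  case False
  then show ?thesis using swap_equal_orbits[OF S a x refl l[symmetric]] that by blast
next
  case True
  let ?O = "orbit a x\<^sub>1" let ?r = "perm_restrict a ?O"
  have OS: "?O \<subseteq> S" by (rule orbit_subset_carrier[OF a x(1)])
  have O: "a z \<in> ?O \<longleftrightarrow> z \<in> ?O" for z
    using orbit_f[OF a S, of z] self_in_orbit[OF a S] orbit_eq_if_mem[OF a S, of _ x\<^sub>1] by metis
  have r: "?r permutes ?O"
  proof (rule bij_imp_permutes)
    have "inj_on ?r ?O" using permutes_inj[OF a] by (auto simp: inj_on_def perm_restrict_def dest: injD)
    moreover have "?r ` ?O \<subseteq> ?O" using O by (auto simp: perm_restrict_def)
    ultimately show "bij_betw ?r ?O ?O"
      using finite_subset[OF OS S] by (simp add: bij_betw_def endo_inj_surj)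
  qed (simp add: perm_restrict_def)
  have "orbit ?r z = ?O" if "z \<in> ?O" for z
  proof -
    have "orbit ?r z = orbit a z"
      by (rule orbit_cong0[of z ?O]) (use that O in \<open>auto simp: perm_restrict_def\<close>)
    then show ?thesis using orbit_eq_if_mem[OF a S that] by simp
  qed
  then have "orbs ?O ?r = {?O}" unfolding orbs_def using self_in_orbit[OF a S, of x\<^sub>1] by auto
  then have "\<not> evenperm ?r" using evenperm_iff_orbs[OF finite_subset[OF OS S] r] True by simp
  moreover have "?r \<circ> a = a \<circ> ?r" using O by (auto simp: fun_eq_iff perm_restrict_def)
  ultimately show ?thesis using that permutes_subset[OF r OS] by blast
qed

text \<open>If all cycles are short, then two of them have the same length.\<close>

lemma long_orbit_or_odd_centralizer:
  assumes S: "finite S" and a: "a permutes S" and large: "card S > c * c"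
  obtains (long) x where "x \<in> S" "card (orbit a x) > c"
    | (odd) \<sigma> where "\<sigma> permutes S" "\<not> evenperm \<sigma>" "\<sigma> \<circ> a = a \<circ> \<sigma>"
proof (cases "\<exists>x\<in>S. card (orbit a x) > c")
  case True
  then show ?thesis using long by blast
next
  case False
  have le: "card V \<in> {1..c}" if V: "V \<in> orbs S a" for V
  proof -
    obtain z where "z \<in> S" "V = orbit a z" using V by (auto simp: orbs_def)
    then show ?thesis using False orbit_nonempty[of a z] finite_subset[OF orbit_subset_carrier[OF a] S]
      by (auto simp: card_gt_0_iff Suc_le_eq not_less)
  qed
  have "\<not> inj_on card (orbs S a)"
  proof
    assume "inj_on card (orbs S a)"
    then have "card (orbs S a) \<le> card {1..c}" by (intro card_inj_on_le[of card]) (use le in auto)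
    moreover have "x \<le> c" if "x \<in># ctype S a" for x using that le S by (auto simp: ctype_def)
    then have "card S \<le> c * card (orbs S a)"
      using sum_mset_le_size[of "ctype S a" c] sum_ctype[OF a S] size_ctype[of S a] by simp
    ultimately have "card S \<le> c * c" by (metis card_atLeastAtMost diff_Suc_1 le_trans mult_le_mono2)
    then show False using large by simp
  qed
  then obtain x y where "x \<in> S" "y \<in> S" "card (orbit a x) = card (orbit a y)" "orbit a x \<noteq> orbit a y"
    unfolding inj_on_def orbs_def by auto
  moreover from this have "y \<notin> orbit a x" using orbit_eq_if_mem[OF a S, of y x] by blast
  ultimately show ?thesis using odd_centralizer_if_equal_orbits[OF S a] odd by metis
qed

section \<open>Changing the parity of the conjugator\<close>

text \<open>The point p lies in a cycle of length l, and M holds the lengths of the other cycles.\<close>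

definition has_cycle :: "'a set \<Rightarrow> ('a \<Rightarrow> 'a) \<Rightarrow> 'a \<Rightarrow> nat \<Rightarrow> nat multiset \<Rightarrow> bool" where
  "has_cycle S f p l M \<longleftrightarrow> f permutes S \<and> p \<in> S \<and> ctype S f = add_mset l M \<and> card (orbit f p) = l"

lemma has_cycle_insert_point:
  assumes f: "has_cycle S f p l M" and x: "finite S" "x \<notin> S"
  shows "has_cycle (insert x S) (f \<circ> tr p x) x (Suc l) M"
  using f permutes_insert_point[of f S p x] ctype_insert_point[of f S x p M]
    card_orbit_insert_point[of f S x p x] x
  unfolding has_cycle_def by auto

lemma has_cycle_insert_four:
  assumes f: "has_cycle S f p l M" and S: "finite S" and w: "distinct [w1, w2, w3, w4]" "{w1, w2, w3, w4} \<inter> S = {}"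
  shows "has_cycle (insert w4 (insert w3 (insert w2 (insert w1 S))))
    (f \<circ> tr p w1 \<circ> tr w1 w2 \<circ> tr w2 w3 \<circ> tr w3 w4) w4 (l + 4) M"
proof -
  have 1: "has_cycle (insert w1 S) (f \<circ> tr p w1) w1 (Suc l) M"
    by (rule has_cycle_insert_point[OF f S]) (use w in auto)
  have 2: "has_cycle (insert w2 (insert w1 S)) (f \<circ> tr p w1 \<circ> tr w1 w2) w2 (Suc (Suc l)) M"
    by (rule has_cycle_insert_point[OF 1]) (use w S in auto)
  have 3: "has_cycle (insert w3 (insert w2 (insert w1 S))) (f \<circ> tr p w1 \<circ> tr w1 w2 \<circ> tr w2 w3) w3 (Suc (Suc (Suc l))) M"
    by (rule has_cycle_insert_point[OF 2]) (use w S in auto)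
  have 4: "has_cycle (insert w4 (insert w3 (insert w2 (insert w1 S))))
    (f \<circ> tr p w1 \<circ> tr w1 w2 \<circ> tr w2 w3 \<circ> tr w3 w4) w4 (Suc (Suc (Suc (Suc l)))) M"
    by (rule has_cycle_insert_point[OF 3]) (use w S in auto)
  then show ?thesis by (simp add: eval_nat_numeral)
qed

text \<open>
  Write e = b q. The factors inserted into a and b are the 5-cycles (e w1 w2 w3 w4) and
  (e w1 w4 w3 w2), with product the 3-cycle (e w2 w1). Conjugating the second one by the odd
  4-cycle (w1 w2 w3 w4) gives (e w2 w1 w4 w3), and the product becomes (e w3 w1). So both products
  insert two of the four new points into the cycle of q and fix the other two, although the second
  factors are conjugate by an odd permutation.
\<close>

lemma flip_products:
  assumes a: "a permutes S" and b: "b permutes S" and q: "q \<in> S"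
    and w: "distinct [w1, w2, w3, w4]" "{w1, w2, w3, w4} \<inter> S = {}"
  defines "a' \<equiv> a \<circ> tr (b q) w1 \<circ> tr w1 w2 \<circ> tr w2 w3 \<circ> tr w3 w4"
    and "b' \<equiv> b \<circ> tr q w1 \<circ> tr w1 w4 \<circ> tr w4 w3 \<circ> tr w3 w2"
    and "\<tau> \<equiv> tr w1 w2 \<circ> tr w2 w3 \<circ> tr w3 w4"
  shows "a' \<circ> b' = (a \<circ> b) \<circ> tr q w2 \<circ> tr w2 w1"
    and "a' \<circ> (\<tau> \<circ> b' \<circ> inv' \<tau>) = (a \<circ> b) \<circ> tr q w3 \<circ> tr w3 w1"
proof -
  have wS: "w1 \<notin> S" "w2 \<notin> S" "w3 \<notin> S" "w4 \<notin> S" using w by auto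
  have fixed: "a w1 = w1" "a w2 = w2" "a w3 = w3" "a w4 = w4" "b w1 = w1" "b w2 = w2" "b w3 = w3" "b w4 = w4"
    using permutes_not_in[OF a] permutes_not_in[OF b] wS by auto
  have bw: "b z = w1 \<longleftrightarrow> z = w1" "b z = w2 \<longleftrightarrow> z = w2" "b z = w3 \<longleftrightarrow> z = w3" "b z = w4 \<longleftrightarrow> z = w4"
    "b z = b q \<longleftrightarrow> z = q" for z
    using permutes_inj[OF b] fixed by (metis injD)+
  have bq: "b q \<in> S" using permutes_in_image[OF b] q by simp
  have neq: "w1 \<noteq> w2" "w1 \<noteq> w3" "w1 \<noteq> w4" "w2 \<noteq> w3" "w2 \<noteq> w4" "w3 \<noteq> w4"
    "q \<noteq> w1" "q \<noteq> w2" "q \<noteq> w3" "q \<noteq> w4" "b q \<noteq> w1" "b q \<noteq> w2" "b q \<noteq> w3" "b q \<noteq> w4"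
    using w q bq by auto
  note neq' = neq neq[symmetric]
  have a'_eq: "a' z = (if z = b q then w1 else if z = w1 then w2 else if z = w2 then w3
     else if z = w3 then w4 else if z = w4 then a (b q) else a z)" for z
    using neq' fixed by (auto simp: a'_def Transposition.transpose_def)
  have b'_eq: "b' z = (if z = q then w1 else if z = w1 then w4 else if z = w4 then w3
     else if z = w3 then w2 else if z = w2 then b q else b z)" for z
    using neq' fixed by (auto simp: b'_def Transposition.transpose_def)
  have \<tau>_eq: "\<tau> z = (if z = w1 then w2 else if z = w2 then w3 else if z = w3 then w4 else if z = w4 then w1 else z)" for z
    using neq' by (auto simp: \<tau>_def Transposition.transpose_def)
  \<comment> \<open>The conjugate of the second factor, in explicit form.\<close>
  define c where "c z = (if z = q then w2 else if z = w2 then w1 else if z = w1 then w4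
     else if z = w4 then w3 else if z = w3 then b q else b z)" for z
  have C1: "((a \<circ> b) \<circ> tr q w2 \<circ> tr w2 w1) z = (if z = q then w2 else if z = w2 then w1 else if z = w1 then a (b q)
     else a (b z))" for z
    using neq' fixed by (auto simp: Transposition.transpose_def)
  have C2: "((a \<circ> b) \<circ> tr q w3 \<circ> tr w3 w1) z = (if z = q then w3 else if z = w3 then w1 else if z = w1 then a (b q)
     else a (b z))" for z
    using neq' fixed by (auto simp: Transposition.transpose_def)
  have "a' (b' z) = ((a \<circ> b) \<circ> tr q w2 \<circ> tr w2 w1) z" for z
    unfolding C1 a'_eq b'_eq using neq' fixed bw[of z] by auto
  then show "a' \<circ> b' = (a \<circ> b) \<circ> tr q w2 \<circ> tr w2 w1" by (simp add: fun_eq_iff)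
  have \<tau>: "\<tau> permutes {w1, w2, w3, w4}"
    unfolding \<tau>_def by (intro permutes_compose permutes_swap_id) auto
  have "\<tau> (b' z) = c (\<tau> z)" for z
    unfolding \<tau>_eq b'_eq c_def using neq' bw[of z] by auto
  then have "\<tau> \<circ> b' = c \<circ> \<tau>" by (simp add: fun_eq_iff)
  then have conj: "\<tau> \<circ> b' \<circ> inv' \<tau> = c" using permutes_inv_o(1)[OF \<tau>] by (metis comp_assoc comp_id)
  have "a' (c z) = ((a \<circ> b) \<circ> tr q w3 \<circ> tr w3 w1) z" for z
    unfolding C2 a'_eq c_def using neq' fixed bw[of z] by auto
  then show "a' \<circ> (\<tau> \<circ> b' \<circ> inv' \<tau>) = (a \<circ> b) \<circ> tr q w3 \<circ> tr w3 w1"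
    unfolding conj by (simp add: fun_eq_iff)
qed

lemma single_cycle_insert2:
  assumes "single_cycle Y C" "finite Y" "x \<notin> Y" "y \<notin> Y" "x \<noteq> y" "q \<in> Y"
  shows "single_cycle (insert y (insert x Y)) (C \<circ> tr q x \<circ> tr x y)"
  by (rule single_cycle_insert[OF single_cycle_insert]) (use assms in auto)

lemma ctype_single_cycle:
  assumes C: "single_cycle Y C" and Y: "Y \<subseteq> S" "Y \<noteq> {}" and S: "finite S"
  shows "ctype S C = add_mset (card Y) (replicate_mset (card (S - Y)) 1)"
proof -
  have finY: "finite Y" using Y S finite_subset by blast
  have CY: "C permutes Y" "\<And>z. z \<in> Y \<Longrightarrow> orbit C z = Y" using C by (auto simp: single_cycle_def)
  have "ctype (Y \<union> R) C = add_mset (card Y) (replicate_mset (card R) 1)" if "finite R" "R \<inter> Y = {}" for R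
    using that
  proof (induction R rule: finite_induct)
    case empty
    have "orbs Y C = {Y}" using CY(2) Y(2) by (auto simp: orbs_def)
    then show ?case by (simp add: ctype_def)
  next
    case (insert x R)
    have "C permutes (Y \<union> R)" by (rule permutes_subset[OF CY(1)]) auto
    then show ?case using ctype_insert_fixed[of C "Y \<union> R" x] insert finY by simp
  qed
  moreover have "Y \<union> (S - Y) = S" "(S - Y) \<inter> Y = {}" using Y by auto
  ultimately show ?thesis using S by (metis finite_Diff)
qed

lemma realizable_edge_duplicate_iter:
  "realizable_edge l m \<mu> \<nu> k \<Longrightarrow> realizable_edge (l + j) (m + j) \<mu> \<nu> (k + j)"
  by (induction j) (auto dest: realizable_edge_duplicate)

text \<open>
  The products have one long cycle and k + 2 fixed points: k from the given pair and two new ones.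
\<close>

lemma flip_if_realizable_edge:
  fixes S :: "nat set"
  assumes R: "realizable_edge l m \<mu> \<nu> k" and S: "finite S" "card S = l + 4 + sum_mset \<mu>"
  obtains a b \<tau> where "a permutes S" "ctype S a = add_mset (l + 4) \<mu>" "b permutes S" "ctype S b = add_mset (m + 4) \<nu>"
    "\<tau> permutes S" "\<not> evenperm \<tau>"
    "ctype S (a \<circ> b) = add_mset (card S - (k + 2)) (replicate_mset (k + 2) 1)"
    "ctype S (a \<circ> (\<tau> \<circ> b \<circ> inv' \<tau>)) = add_mset (card S - (k + 2)) (replicate_mset (k + 2) 1)"
proof -
  have "card S = Suc (Suc (l + 2 + sum_mset \<mu>))" using S(2) by simp
  then obtain w4 w3 S' where 1: "S = insert w4 (insert w3 S')" "w3 \<notin> S'" "w4 \<notin> S'" "w3 \<noteq> w4"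
    "finite S'" "card S' = l + 2 + sum_mset \<mu>"
    using card_eq_SucSucE[OF S(1)] by metis
  have "card S' = Suc (Suc (l + sum_mset \<mu>))" using 1(6) by simp
  then obtain w2 w1 T where 2: "S' = insert w2 (insert w1 T)" "w1 \<notin> T" "w2 \<notin> T" "w1 \<noteq> w2"
    "finite T" "card T = l + sum_mset \<mu>"
    using card_eq_SucSucE[OF 1(5)] by metis
  have w: "distinct [w1, w2, w3, w4]" "{w1, w2, w3, w4} \<inter> T = {}" using 1 2 by auto
  have Seq: "S = insert w4 (insert w3 (insert w2 (insert w1 T)))" using 1(1) 2(1) by simp
  obtain a b Y q where U: "unicellular T a b Y" and ct: "ctype T a = add_mset l \<mu>" "ctype T b = add_mset m \<nu>"
    and k: "card T = card Y + k" and q: "q \<in> Y" "card (orbit a (b q)) = l" "card (orbit b q) = m"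
    using R 2(5,6) unfolding realizable_edge_def by blast
  have a: "a permutes T" and b: "b permutes T" and Y: "Y \<subseteq> T" and C: "single_cycle Y (a \<circ> b)"
    using U by (auto simp: unicellular_def)
  have qT: "q \<in> T" "b q \<in> T" using q(1) Y permutes_in_image[OF b] by auto
  have finY: "finite Y" using Y 2(5) finite_subset by blast
  have wY: "w1 \<notin> Y" "w2 \<notin> Y" "w3 \<notin> Y" "w4 \<notin> Y" using Y w(2) by auto
  define a' where "a' = a \<circ> tr (b q) w1 \<circ> tr w1 w2 \<circ> tr w2 w3 \<circ> tr w3 w4"
  define b' where "b' = b \<circ> tr q w1 \<circ> tr w1 w4 \<circ> tr w4 w3 \<circ> tr w3 w2"
  define \<tau> where "\<tau> = tr w1 w2 \<circ> tr w2 w3 \<circ> tr w3 w4"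
  have "has_cycle T a (b q) l \<mu>" using a qT ct q by (simp add: has_cycle_def)
  from has_cycle_insert_four[OF this 2(5) w]
  have a': "a' permutes S" "ctype S a' = add_mset (l + 4) \<mu>"
    unfolding a'_def Seq by (simp_all add: has_cycle_def)
  have "has_cycle T b q m \<nu>" using b qT ct q by (simp add: has_cycle_def)
  from has_cycle_insert_four[OF this 2(5), of w1 w4 w3 w2] w
  have b': "b' permutes S" "ctype S b' = add_mset (m + 4) \<nu>"
    unfolding b'_def Seq by (auto simp: has_cycle_def insert_commute)
  have \<tau>: "\<tau> permutes S" unfolding \<tau>_def Seq by (intro permutes_compose permutes_swap_id) auto
  have odd: "\<not> evenperm \<tau>" using w(1) unfolding \<tau>_def
    by (simp add: evenperm_comp permutation_compose permutation_swap_id evenperm_swap)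
  have c: "ctype S D = add_mset (card S - (k + 2)) (replicate_mset (k + 2) 1)"
    if D: "single_cycle (insert y (insert x Y)) D" and xy: "x \<in> {w1, w2, w3, w4}" "y \<in> {w1, w2, w3, w4}" "x \<noteq> y" for D x y
  proof -
    let ?Y = "insert y (insert x Y)"
    have YS: "?Y \<subseteq> S" using Y xy Seq by auto
    have "card ?Y = card Y + 2" using xy wY finY by auto
    moreover have "card S = card T + 4" using S(2) 2(6) by simp
    ultimately have "card ?Y = card S - (k + 2)" "card (S - ?Y) = k + 2"
      using k card_Diff_subset[OF finite_subset[OF YS S(1)] YS] by auto
    then show ?thesis using ctype_single_cycle[OF D YS _ S(1)] by simp
  qed
  have "ctype S (a' \<circ> b') = add_mset (card S - (k + 2)) (replicate_mset (k + 2) 1)"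
    unfolding a'_def b'_def flip_products(1)[OF a b qT(1) w]
    by (rule c[OF single_cycle_insert2[OF C finY]]) (use wY q(1) w in auto)
  moreover have "ctype S (a' \<circ> (\<tau> \<circ> b' \<circ> inv' \<tau>)) = add_mset (card S - (k + 2)) (replicate_mset (k + 2) 1)"
    unfolding a'_def b'_def \<tau>_def flip_products(2)[OF a b qT(1) w]
    by (rule c[OF single_cycle_insert2[OF C finY]]) (use wY q(1) w in auto)
  ultimately show ?thesis using that[OF a' b' \<tau> odd] by blast
qed

section \<open>Products of even permutations with few cycles\<close>

text \<open>
  One cycle of length n - k and k fixed points; as a partition of n this is a hook.
\<close>

abbreviation hook_type :: "nat \<Rightarrow> nat \<Rightarrow> nat multiset" where
  "hook_type n k \<equiv> add_mset (n - k) (replicate_mset k 1)"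

text \<open>
  Used to pass from a realization of two cycle types to given permutations of these types: a
  conjugator of the second factor there becomes one of the second factor here.
\<close>

lemma conj_transport:
  assumes perms: "a permutes S" "b permutes S" "g permutes S" "f permutes S" "\<tau> permutes S"
  shows "(g \<circ> a \<circ> inv' g) \<circ> ((g \<circ> \<tau> \<circ> inv' f) \<circ> (f \<circ> b \<circ> inv' f) \<circ> inv' (g \<circ> \<tau> \<circ> inv' f)) =
    g \<circ> (a \<circ> (\<tau> \<circ> b \<circ> inv' \<tau>)) \<circ> inv' g"
proof -
  note bij = permutes_bij[OF perms(3)] permutes_bij[OF perms(4)] permutes_bij[OF perms(5)]
  have inv: "inv' (g \<circ> \<tau> \<circ> inv' f) = f \<circ> inv' \<tau> \<circ> inv' g"
    using bij by (simp add: o_inv_distrib bij_comp bij_imp_bij_inv inv_inv_eq o_assoc)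
  show ?thesis unfolding inv
    using permutes_inverses(2)[OF perms(3)] permutes_inverses(2)[OF perms(4)] by (simp add: fun_eq_iff)
qed

lemma evenperm_comp_permutes: "f permutes S \<Longrightarrow> g permutes S \<Longrightarrow> finite S \<Longrightarrow>
    evenperm (f \<circ> g) \<longleftrightarrow> (evenperm f \<longleftrightarrow> evenperm g)"
  by (simp add: evenperm_comp permutation_if_permutes)

text \<open>
  The previous results give a conjugator h in the symmetric group. If an odd permutation commutes
  with a, it can be multiplied to h from the left and merely conjugates the product; if one commutes
  with b, it can be multiplied to h from the right and changes nothing. Otherwise a and b have cycles
  of length at least 8. Then 6 + j points with j = k - 2 are removed from these cycles: two are used
  for a pair of edges, one of which is doubled j times, and four for the 5-cycles that offer
  conjugators of both parities.
\<close>

lemma even_conj_product_hook: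
  assumes S: "finite (S :: nat set)" "card S = n" and a: "a permutes S" "evenperm a" and b: "b permutes S" "evenperm b"
    and few: "card (orbs S a) + card (orbs S b) + 10 \<le> n" and n: "49 < n"
    and k: "k = (if even n then 3 else 2)"
  obtains h where "h permutes S" "evenperm h" "ctype S (a \<circ> (h \<circ> b \<circ> inv' h)) = hook_type n k"
proof -
  have par: "even (n + size (ctype S a))" "even (n + size (ctype S b))"
    using evenperm_iff_orbs[OF S(1) a(1)] evenperm_iff_orbs[OF S(1) b(1)] a b S by (auto simp: size_ctype)
  have transport: "\<exists>g f. g permutes S \<and> f permutes S \<and>
      (\<forall>\<tau>. \<tau> permutes S \<longrightarrow> ctype S (a \<circ> ((g \<circ> \<tau> \<circ> inv' f) \<circ> b \<circ> inv' (g \<circ> \<tau> \<circ> inv' f))) =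
        ctype S (a' \<circ> (\<tau> \<circ> b' \<circ> inv' \<tau>)))"
    if H: "a' permutes S" "ctype S a' = ctype S a" "b' permutes S" "ctype S b' = ctype S b" for a' b'
  proof -
    obtain g where g: "g permutes S" "g \<circ> a' \<circ> inv' g = a" using conj_if_ctype_eq[OF S(1) H(1) a(1) H(2)] .
    obtain f where f: "f permutes S" "f \<circ> b' \<circ> inv' f = b" using conj_if_ctype_eq[OF S(1) H(3) b(1) H(4)] .
    have "ctype S (a \<circ> ((g \<circ> \<tau> \<circ> inv' f) \<circ> b \<circ> inv' (g \<circ> \<tau> \<circ> inv' f))) = ctype S (a' \<circ> (\<tau> \<circ> b' \<circ> inv' \<tau>))"
      if \<tau>: "\<tau> permutes S" for \<tau>
    proof -
      have "a' \<circ> (\<tau> \<circ> b' \<circ> inv' \<tau>) permutes S"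
        by (rule permutes_compose[OF permutes_conj[OF H(3) \<tau>] H(1)])
      then show ?thesis
        using conj_transport[OF H(1,3) g(1) f(1) \<tau>] ctype_conj[OF _ g(1) S(1)] unfolding g(2) f(2) by simp
    qed
    then show ?thesis using g(1) f(1) by blast
  qed
  have any: "\<exists>h. h permutes S \<and> ctype S (a \<circ> (h \<circ> b \<circ> inv' h)) = hook_type n k"
  proof -
    have "realizable (ctype S a) (ctype S b) k"
    proof (rule realizable_if_large)
      show "sum_mset (ctype S a) = n" "sum_mset (ctype S b) = n" using sum_ctype a b S by auto
      show "0 \<notin># ctype S a" "0 \<notin># ctype S b" using ctype_pos a b S by auto
      show "size (ctype S a) + size (ctype S b) + 3 * k + 1 \<le> n" using few k by (simp add: size_ctype)
      show "odd (n + k + size (ctype S a) + size (ctype S b))" using par k by (auto split: if_splits)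
    qed
    then obtain a' b' Y where U: "unicellular S a' b' Y" and ct: "ctype S a' = ctype S a" "ctype S b' = ctype S b"
      and Y: "card S = card Y + k"
      using S sum_ctype[OF a(1) S(1)] unfolding realizable_def by metis
    have a': "a' permutes S" and b': "b' permutes S" and YS: "Y \<subseteq> S" and C: "single_cycle Y (a' \<circ> b')"
      using U by (auto simp: unicellular_def)
    have "Y \<noteq> {}" using Y S n k by (auto split: if_splits)
    then have "ctype S (a' \<circ> b') = hook_type n k"
      using ctype_single_cycle[OF C YS _ S(1)] Y S card_Diff_subset[OF finite_subset[OF YS S(1)] YS] by simp
    moreover obtain g f where "g permutes S" "f permutes S"
      "ctype S (a \<circ> ((g \<circ> id \<circ> inv' f) \<circ> b \<circ> inv' (g \<circ> id \<circ> inv' f))) = ctype S (a' \<circ> (id \<circ> b' \<circ> inv' id))"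
      using transport[OF a' ct(1) b' ct(2)] permutes_id by blast
    ultimately show ?thesis
      by (intro exI[of _ "g \<circ> inv' f"]) (simp add: permutes_compose permutes_inv)
  qed
  show ?thesis
  proof (rule long_orbit_or_odd_centralizer[OF S(1) a(1), of 7])
    show "7 * 7 < card S" using n S by simp
  next
    fix \<sigma> assume \<sigma>: "\<sigma> permutes S" "\<not> evenperm \<sigma>" "\<sigma> \<circ> a = a \<circ> \<sigma>"
    obtain h where h: "h permutes S" "ctype S (a \<circ> (h \<circ> b \<circ> inv' h)) = hook_type n k" using any by blast
    let ?b = "h \<circ> b \<circ> inv' h"
    have inv: "inv' (\<sigma> \<circ> h) = inv' h \<circ> inv' \<sigma>"
      by (rule o_inv_distrib[OF permutes_bij[OF \<sigma>(1)] permutes_bij[OF h(1)]])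
    have b': "?b permutes S" by (rule permutes_conj[OF b(1) h(1)])
    have "a \<circ> (\<sigma> \<circ> h \<circ> b \<circ> inv' (\<sigma> \<circ> h)) = (a \<circ> \<sigma>) \<circ> ?b \<circ> inv' \<sigma>" unfolding inv by (simp only: o_assoc)
    also have "\<dots> = \<sigma> \<circ> (a \<circ> ?b) \<circ> inv' \<sigma>" unfolding \<sigma>(3)[symmetric] by (simp only: o_assoc)
    finally have "ctype S (a \<circ> (\<sigma> \<circ> h \<circ> b \<circ> inv' (\<sigma> \<circ> h))) = hook_type n k"
      using ctype_conj[OF permutes_compose[OF b' a(1)] \<sigma>(1) S(1)] h(2) by simp
    moreover have "evenperm h \<or> evenperm (\<sigma> \<circ> h)" using evenperm_comp_permutes[OF \<sigma>(1) h(1) S(1)] \<sigma>(2) by blast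
    ultimately show ?thesis using that[of h] that[of "\<sigma> \<circ> h"] h permutes_compose[OF h(1) \<sigma>(1)] by blast
  next
    fix x assume x: "x \<in> S" "7 < card (orbit a x)"
    show ?thesis
    proof (rule long_orbit_or_odd_centralizer[OF S(1) b(1), of 7])
      show "7 * 7 < card S" using n S by simp
    next
      fix \<sigma> assume \<sigma>: "\<sigma> permutes S" "\<not> evenperm \<sigma>" "\<sigma> \<circ> b = b \<circ> \<sigma>"
      obtain h where h: "h permutes S" "ctype S (a \<circ> (h \<circ> b \<circ> inv' h)) = hook_type n k" using any by blast
      have inv: "inv' (h \<circ> \<sigma>) = inv' \<sigma> \<circ> inv' h"
        by (rule o_inv_distrib[OF permutes_bij[OF h(1)] permutes_bij[OF \<sigma>(1)]])
      have "h \<circ> \<sigma> \<circ> b \<circ> inv' (h \<circ> \<sigma>) = h \<circ> (\<sigma> \<circ> b) \<circ> inv' \<sigma> \<circ> inv' h" unfolding inv by (simp only: o_assoc)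
      also have "\<dots> = h \<circ> b \<circ> inv' h"
        unfolding \<sigma>(3) using permutes_inverses(1)[OF \<sigma>(1)] by (simp add: fun_eq_iff)
      finally have "ctype S (a \<circ> (h \<circ> \<sigma> \<circ> b \<circ> inv' (h \<circ> \<sigma>))) = hook_type n k" using h(2) by simp
      moreover have "evenperm h \<or> evenperm (h \<circ> \<sigma>)" using evenperm_comp_permutes[OF h(1) \<sigma>(1) S(1)] \<sigma>(2) by blast
      ultimately show ?thesis using that[of h] that[of "h \<circ> \<sigma>"] h permutes_compose[OF \<sigma>(1) h(1)] by blast
    next
      fix y assume y: "y \<in> S" "7 < card (orbit b y)"
      define j where "j = k - 2"
      have j: "j \<le> 1" "k = j + 2" "odd (n + j)" using k by (auto simp: j_def split: if_splits)
      define l m where "l = card (orbit a x) - (6 + j)" and "m = card (orbit b y) - (6 + j)"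
      have lm: "card (orbit a x) = l + 6 + j" "card (orbit b y) = m + 6 + j" "l \<noteq> 0" "m \<noteq> 0"
        using x y j by (auto simp: l_def m_def)
      obtain \<mu> where \<mu>: "ctype S a = add_mset (l + 6 + j) \<mu>" using ctype_remove_orbit[OF S(1) x(1), of a] lm by metis
      obtain \<nu> where \<nu>: "ctype S b = add_mset (m + 6 + j) \<nu>" using ctype_remove_orbit[OF S(1) y(1), of b] lm by metis
      have sums: "l + 6 + j + sum_mset \<mu> = n" "m + 6 + j + sum_mset \<nu> = n"
        using sum_ctype[OF a(1) S(1)] sum_ctype[OF b(1) S(1)] S(2) \<mu> \<nu> by simp_all
      have sizes: "size (ctype S a) = Suc (size \<mu>)" "size (ctype S b) = Suc (size \<nu>)" using \<mu> \<nu> by simp_all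
      have pos: "0 \<notin># \<mu>" "0 \<notin># \<nu>" using ctype_pos[OF a(1) S(1)] ctype_pos[OF b(1) S(1)] \<mu> \<nu> by auto
      have "realizable (add_mset l \<mu>) (add_mset m \<nu>) 0"
      proof (rule realizable_0[of _ "n - (6 + j)"])
        show "sum_mset (add_mset l \<mu>) = n - (6 + j)" "sum_mset (add_mset m \<nu>) = n - (6 + j)" using sums by auto
        show "0 \<notin># add_mset l \<mu>" "0 \<notin># add_mset m \<nu>" using pos lm by auto
        show "size (add_mset l \<mu>) + size (add_mset m \<nu>) < n - (6 + j)"
          using few sizes j by (simp add: size_ctype[symmetric])
        show "odd (n - (6 + j) + size (add_mset l \<mu>) + size (add_mset m \<nu>))"
          using par j(3) sizes n j(1) by simp
      qed
      then have "realizable_edge (l + 2) (m + 2) \<mu> \<nu> 0" by (rule realizable_pair_same)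
      then have R: "realizable_edge (l + 2 + j) (m + 2 + j) \<mu> \<nu> j"
        using realizable_edge_duplicate_iter[of "l + 2" "m + 2" \<mu> \<nu> 0 j] by simp
      have card: "card S = l + 2 + j + 4 + sum_mset \<mu>" using sums S by simp
      obtain a' b' \<tau> where F: "a' permutes S" "ctype S a' = add_mset (l + 2 + j + 4) \<mu>" "b' permutes S"
        "ctype S b' = add_mset (m + 2 + j + 4) \<nu>" "\<tau> permutes S" "\<not> evenperm \<tau>"
        "ctype S (a' \<circ> b') = add_mset (card S - (j + 2)) (replicate_mset (j + 2) 1)"
        "ctype S (a' \<circ> (\<tau> \<circ> b' \<circ> inv' \<tau>)) = add_mset (card S - (j + 2)) (replicate_mset (j + 2) 1)"
        using flip_if_realizable_edge[OF R S(1) card] .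
      have ct: "ctype S a' = ctype S a" "ctype S b' = ctype S b" unfolding F \<mu> \<nu> by simp_all
      obtain g f where gf: "g permutes S" "f permutes S" and tr: "\<And>\<tau>. \<tau> permutes S \<Longrightarrow>
        ctype S (a \<circ> ((g \<circ> \<tau> \<circ> inv' f) \<circ> b \<circ> inv' (g \<circ> \<tau> \<circ> inv' f))) = ctype S (a' \<circ> (\<tau> \<circ> b' \<circ> inv' \<tau>))"
        using transport[OF F(1) ct(1) F(3) ct(2)] by blast
      have f': "inv' f permutes S" by (rule permutes_inv[OF gf(2)])
      have p: "g \<circ> \<rho> \<circ> inv' f permutes S" if "\<rho> permutes S" for \<rho>
        by (rule permutes_compose[OF f' permutes_compose[OF that gf(1)]])
      have hook: "ctype S (a \<circ> ((g \<circ> \<rho> \<circ> inv' f) \<circ> b \<circ> inv' (g \<circ> \<rho> \<circ> inv' f))) = hook_type n k" if "\<rho> \<in> {id, \<tau>}" for \<rho>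
        using that tr[OF permutes_id] tr[OF F(5)] F(7,8) S(2) j(2) by auto
      have "evenperm (g \<circ> id \<circ> inv' f) \<or> evenperm (g \<circ> \<tau> \<circ> inv' f)"
        using evenperm_comp_permutes[OF permutes_compose[OF F(5) gf(1)] f' S(1)] evenperm_comp_permutes[OF gf(1) F(5) S(1)]
          evenperm_comp_permutes[OF gf(1) f' S(1)] F(6) by auto
      then show ?thesis using that[OF p[OF permutes_id] _ hook] that[OF p[OF F(5)] _ hook] by blast
    qed
  qed
qed

text \<open>The transposition of two fixed points of t is odd and commutes with t.\<close>

lemma conj_hook_even:
  assumes S: "finite S" and t: "t permutes S" "ctype S t = hook_type n k" and u: "u permutes S" "ctype S u = hook_type n k"
    and k: "2 \<le> k"
  obtains h where "h permutes S" "evenperm h" "h \<circ> t \<circ> inv' h = u"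
proof -
  obtain h where h: "h permutes S" "h \<circ> t \<circ> inv' h = u"
    using conj_if_ctype_eq[OF S t(1) u(1)] t(2) u(2) by metis
  obtain j where "k = Suc (Suc j)" using k by (metis add_2_eq_Suc le_iff_add)
  then have "ctype S t = add_mset 1 (add_mset 1 (add_mset (n - k) (replicate_mset j 1)))" using t(2) by simp
  then obtain p q where pq: "p \<in> S" "card (orbit t p) = 1" "q \<in> S" "card (orbit t q) = 1" "q \<notin> orbit t p"
    by (rule ctype_add_mset2E[OF t(1) S])
  have fixed: "t p = p" "t q = q" using pq(2,4) card_orbit_eq_1_iff[OF t(1) S] by simp_all
  have neq: "p \<noteq> q" using pq(5) self_in_orbit[OF t(1) S, of p] by auto
  have "tr p q (t (tr p q z)) = t z" for z
    using fixed injD[OF permutes_inj[OF t(1)], of z p] injD[OF permutes_inj[OF t(1)], of z q]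
    by (auto simp: Transposition.transpose_def)
  then have comm: "tr p q \<circ> t \<circ> tr p q = t" by (simp add: fun_eq_iff)
  have inv: "inv' (h \<circ> tr p q) = tr p q \<circ> inv' h" using o_inv_distrib[OF permutes_bij[OF h(1)], of "tr p q"] by simp
  have "h \<circ> tr p q \<circ> t \<circ> inv' (h \<circ> tr p q) = h \<circ> (tr p q \<circ> t \<circ> tr p q) \<circ> inv' h" unfolding inv by (simp only: o_assoc)
  then have "h \<circ> tr p q \<circ> t \<circ> inv' (h \<circ> tr p q) = u" unfolding comm h(2) .
  then show ?thesis
    using that[of h] that[of "h \<circ> tr p q"] h permutes_comp_tr[OF h(1) pq(1,3)] evenperm_comp_tr[OF h(1) S neq] by blast
qed

lemma two_size_le:
  fixes M :: "nat multiset"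
  assumes "0 \<notin># M" shows "2 * size M \<le> sum_mset M + count M 1"
  using assms
proof (induction M)
  case (add x M)
  then have "2 * size M \<le> sum_mset M + count M 1" "x \<noteq> 0" by auto
  then show ?case by (cases "x = 1") auto
qed simp

lemma count_ctype_1_le:
  assumes g: "g permutes S" "finite S" shows "count (ctype S g) 1 \<le> card {x \<in> S. g x = x}"
proof -
  have "count (ctype S g) 1 = card {V \<in> orbs S g. card V = 1}"
    using g(2) unfolding ctype_def by (subst count_image_mset_eq_card_vimage) (auto intro: arg_cong[of _ _ card])
  also have "\<dots> \<le> card ((\<lambda>x. {x}) ` {x \<in> S. g x = x})"
  proof (rule card_mono)
    show "{V \<in> orbs S g. card V = 1} \<subseteq> (\<lambda>x. {x}) ` {x \<in> S. g x = x}"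
    proof
      fix V assume V: "V \<in> {V \<in> orbs S g. card V = 1}"
      then obtain x where x: "x \<in> S" "V = orbit g x" by (auto simp: orbs_def)
      then have "g x = x" using V card_orbit_eq_1_iff[OF g, of x] by simp
      then have "V = {x}" using x(2) orbit_fixpoint[of g x] by simp
      then show "V \<in> (\<lambda>x. {x}) ` {x \<in> S. g x = x}" using x(1) \<open>g x = x\<close> by blast
    qed
  qed (use g in simp)
  also have "\<dots> \<le> card {x \<in> S. g x = x}" by (rule card_image_le) (use g in simp)
  finally show ?thesis .
qed

lemma single_cycle_if_orbs:
  "f permutes Y \<Longrightarrow> orbs Y f = {Y} \<Longrightarrow> single_cycle Y f"
  unfolding single_cycle_def orbs_def by blast

lemma card_orbs_less:
  assumes g: "g permutes S" "finite S" "g \<noteq> id" shows "card (orbs S g) < card S"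
proof -
  obtain x where x: "g x \<noteq> x" using g(3) by (auto simp: fun_eq_iff)
  define T where "T = S - {x}"
  have xS: "x \<in> S" using x permutes_not_in[OF g(1)] by blast
  then have T: "S = insert x T" "x \<notin> T" "finite T" using g(2) by (auto simp: T_def)
  then obtain g0 p where g0: "g0 permutes T" "p \<in> T" "g = g0 \<circ> tr p x"
    using remove_point[of g x T] g(1) x by metis
  have "card (orbs S g) = card (orbs T g0)"
    unfolding T(1) g0(3) by (rule card_orbs_insert_point[OF g0(1) T(3,2) g0(2)])
  also have "\<dots> \<le> card T" unfolding orbs_def by (rule card_image_le[OF T(3)])
  also have "\<dots> < card S" using T by simp
  finally show ?thesis .
qed

text \<open>
  If g has k fixed points, leave them aside and multiply g by a full cycle on the other n - k points,
  conjugated so that the product is a full cycle again. If g has fewer fixed points, then it has at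
  most about n / 2 cycles, and so g and a hook have few enough cycles for a product that is a hook.
\<close>

lemma even_perm_product_of_hooks:
  assumes S: "finite (S :: nat set)" "card S = n" and g: "g permutes S" "evenperm g" and n: "49 < n"
    and k: "k = (if even n then 3 else 2)"
  obtains t u where "t permutes S" "ctype S t = hook_type n k" "u permutes S" "ctype S u = hook_type n k" "g = t \<circ> u"
proof -
  have k3: "k \<le> 3" and nk: "odd (n + k)" "0 < n - k" using k n by (auto split: if_splits)
  have pos: "0 \<notin># hook_type n k" using nk(2) by (auto split: if_splits)
  consider "g = id" | "g \<noteq> id" "k \<le> card {x \<in> S. g x = x}" | "card {x \<in> S. g x = x} < k" by linarith
  then show ?thesis
  proof cases
    case 1
    obtain t where t: "t permutes S" "ctype S t = hook_type n k"
      using exists_ctype[OF pos S(1)] S(2) nk(2) by auto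
    then show ?thesis
      using that[OF t permutes_inv[OF t(1)]] ctype_inv[OF t(1) S(1)] 1 permutes_inv_o(1)[OF t(1)] by simp
  next
    case 2
    obtain F where F: "F \<subseteq> {x \<in> S. g x = x}" "card F = k" by (rule obtain_subset_with_card_n[OF 2(2)])
    define Y where "Y = S - F"
    have FS: "F \<subseteq> S" "finite F" using F(1) S(1) finite_subset[of F S] by auto
    have Y: "Y \<subseteq> S" "finite Y" "card Y = n - k" "card (S - Y) = k" "Y \<noteq> {}"
    proof -
      show "card Y = n - k" using card_Diff_subset[OF FS(2,1)] S F by (simp add: Y_def)
      then show "Y \<noteq> {}" using nk by auto
      have "S - Y = F" using FS by (auto simp: Y_def)
      then show "card (S - Y) = k" using F by simp
    qed (use S in \<open>auto simp: Y_def\<close>)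
    have gY: "g permutes Y" by (rule permutes_superset[OF g(1)]) (use F in \<open>auto simp: Y_def\<close>)
    obtain c where c: "c permutes Y" "ctype Y c = {#n - k#}"
      using exists_ctype[of "{#n - k#}" Y] Y nk by auto
    have c1: "card (orbs Y c) = 1" using c(2) size_ctype[of Y c] by simp
    have par: "even (card Y + card (orbs Y g))" using evenperm_iff_orbs[OF Y(2) gY] g(2) by simp
    have "card Y \<noteq> Suc (card (orbs Y g))"
    proof
      assume "card Y = Suc (card (orbs Y g))"
      then show False using par by simp
    qed
    then have less: "card (orbs Y g) + card (orbs Y c) < card Y"
      using card_orbs_less[OF gY Y(2) 2(1)] c1 by linarith
    have odd: "odd (card (orbs Y g) + card (orbs Y c) + card Y)" using par c1 by simp
    obtain h where h: "h permutes Y" "orbs Y (g \<circ> (h \<circ> c \<circ> inv' h)) = {Y}"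
      using exists_conj_one_cycle[OF gY c(1) Y(2) less odd] .
    let ?c = "h \<circ> c \<circ> inv' h"
    have c': "?c permutes Y" by (rule permutes_conj[OF c(1) h(1)])
    have hook: "f permutes S \<and> ctype S f = hook_type n k" if "f permutes Y" "orbs Y f = {Y}" for f
      using ctype_single_cycle[OF single_cycle_if_orbs[OF that] Y(1,5) S(1)] permutes_subset[OF that(1) Y(1)] Y by simp
    have "card (orbs Y ?c) = 1" using card_orbs_conj[OF c(1) h(1) Y(2)] c1 by simp
    then obtain V where V: "orbs Y ?c = {V}" by (auto simp: card_1_singleton_iff)
    moreover have "\<Union>(orbs Y ?c) = Y" using permutes_in_image[OF c'] by (intro Union_orbs_closed[OF c' Y(2)]) simp
    ultimately have "orbs Y ?c = {Y}" by simp
    then have u: "inv' ?c permutes S \<and> ctype S (inv' ?c) = hook_type n k"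
      by (intro hook) (use permutes_inv[OF c'] orbs_inv[OF c' Y(2)] in auto)
    have t: "g \<circ> ?c permutes S \<and> ctype S (g \<circ> ?c) = hook_type n k"
      by (rule hook[OF permutes_compose[OF c' gY] h(2)])
    have "g = (g \<circ> ?c) \<circ> inv' ?c" using permutes_inv_o(1)[OF c'] by (simp only: comp_assoc comp_id)
    then show ?thesis using that t u by blast
  next
    case 3
    have "0 \<notin># ctype S g" by (rule ctype_pos[OF g(1) S(1)])
    then have size: "2 * size (ctype S g) < n + k"
      using two_size_le count_ctype_1_le[OF g(1) S(1)] 3 sum_ctype[OF g(1) S(1)] S(2) by fastforce
    have par: "even (n + size (ctype S g))"
      using evenperm_iff_orbs[OF S(1) g(1)] g(2) S(2) by (simp add: size_ctype)
    have "realizable (ctype S g) (hook_type n k) k"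
    proof (rule realizable_if_large)
      show "sum_mset (ctype S g) = n" using sum_ctype[OF g(1) S(1)] S(2) by simp
      show "sum_mset (hook_type n k) = n" using nk by simp
      show "0 \<notin># ctype S g" by fact
      show "0 \<notin># hook_type n k" by fact
      show "size (ctype S g) + size (hook_type n k) + 3 * k + 1 \<le> n" using size k3 n by simp
      show "odd (n + k + size (ctype S g) + size (hook_type n k))" using par by simp blast
    qed
    then obtain a b Y where U: "unicellular S a b Y" and ct: "ctype S a = ctype S g" "ctype S b = hook_type n k"
      and Y: "card S = card Y + k"
      using S sum_ctype[OF g(1) S(1)] unfolding realizable_def by metis
    have a: "a permutes S" and b: "b permutes S" and YS: "Y \<subseteq> S" and C: "single_cycle Y (a \<circ> b)"
      using U by (auto simp: unicellular_def)
    have "Y \<noteq> {}" using Y S n k3 by auto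
    then have ab: "ctype S (a \<circ> b) = hook_type n k"
      using ctype_single_cycle[OF C YS _ S(1)] Y S card_Diff_subset[OF finite_subset[OF YS S(1)] YS] by simp
    obtain h where h: "h permutes S" "h \<circ> a \<circ> inv' h = g" using conj_if_ctype_eq[OF S(1) a g(1) ct(1)] .
    have t: "h \<circ> (a \<circ> b) \<circ> inv' h permutes S" "ctype S (h \<circ> (a \<circ> b) \<circ> inv' h) = hook_type n k"
      using permutes_conj[OF permutes_compose[OF b a] h(1)] ctype_conj[OF permutes_compose[OF b a] h(1) S(1)] ab by auto
    have u: "h \<circ> inv' b \<circ> inv' h permutes S" "ctype S (h \<circ> inv' b \<circ> inv' h) = hook_type n k"
      using permutes_conj[OF permutes_inv[OF b] h(1)] ctype_conj[OF permutes_inv[OF b] h(1) S(1)]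
        ctype_inv[OF b S(1)] ct(2) by auto
    have "g = (h \<circ> (a \<circ> b) \<circ> inv' h) \<circ> (h \<circ> inv' b \<circ> inv' h)"
      unfolding h(2)[symmetric] using permutes_inverses(2)[OF h(1)] permutes_inverses(1)[OF b] by (simp add: fun_eq_iff)
    then show ?thesis by (rule that[OF t u])
  qed
qed

section \<open>Large sets of permutations contain permutations with few cycles\<close>

text \<open>
  A permutation of S and one more point x either fixes x and loses a cycle when x is deleted, or
  arises by inserting x after a point of S into a permutation of S with the same number of cycles.
\<close>

lemma card_perms_many_orbs:
  assumes "finite S" "card S \<le> m" "0 < m"
  shows "card {f. f permutes S \<and> card S \<le> card (orbs S f) + j} \<le> 2 ^ card S * m ^ j"
  using assms
proof (induction S arbitrary: j rule: finite_induct)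
  case empty
  then show ?case by (simp add: orbs_def Suc_le_eq)
next
  case (insert x S)
  define P where "P i = {f. f permutes S \<and> card S \<le> card (orbs S f) + i}" for i
  have fin: "finite (P i)" for i using finite_permutations[OF insert.hyps(1)] by (simp add: P_def)
  have IH: "card (P i) \<le> 2 ^ card S * m ^ i" for i using insert.IH[of i] insert.prems insert.hyps by (simp add: P_def)
  define Q where "Q = {f. f permutes S \<and> Suc (card S) \<le> card (orbs S f) + j}"
  have finQ: "finite Q" using finite_permutations[OF insert.hyps(1)] by (simp add: Q_def)
  have Q: "m * card Q \<le> 2 ^ card S * m ^ j"
  proof (cases j)
    case 0
    have "card (orbs S f) \<le> card S" for f unfolding orbs_def by (rule card_image_le[OF insert.hyps(1)])
    then have "Q = {}" unfolding Q_def 0 by (auto simp: not_less_eq_eq[symmetric])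
    then show ?thesis by simp
  next
    case (Suc i)
    then have "Q = P i" by (auto simp: Q_def P_def)
    then show ?thesis using IH[of i] Suc by (simp add: mult.left_commute)
  qed
  have "{f. f permutes insert x S \<and> card (insert x S) \<le> card (orbs (insert x S) f) + j}
      \<subseteq> P j \<union> (\<lambda>(p, g). g \<circ> tr p x) ` (S \<times> Q)"
  proof safe
    fix f assume f: "f permutes insert x S" "card (insert x S) \<le> card (orbs (insert x S) f) + j"
      and nim: "f \<notin> (\<lambda>(p, g). g \<circ> tr p x) ` (S \<times> Q)"
    show "f \<in> P j"
    proof (cases "f x = x")
      case True
      with f(1) have "f permutes S" by (rule permutes_if_fixed)
      then show ?thesis using f(2) insert.hyps card_orbs_insert_fixed[of f S x] by (simp add: P_def)
    next
      case False
      obtain g p where g: "g permutes S" "p \<in> S" "f = g \<circ> tr p x"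
        using remove_point[OF f(1) insert.hyps(2) False] .
      have "card (orbs (insert x S) f) = card (orbs S g)"
        unfolding g(3) by (rule card_orbs_insert_point[OF g(1) insert.hyps g(2)])
      then have "g \<in> Q" using f(2) insert.hyps g(1) by (simp add: Q_def)
      then show ?thesis using nim g by auto
    qed
  qed
  then have "card {f. f permutes insert x S \<and> card (insert x S) \<le> card (orbs (insert x S) f) + j}
      \<le> card (P j \<union> (\<lambda>(p, g). g \<circ> tr p x) ` (S \<times> Q))"
    using fin finQ insert.hyps by (intro card_mono) auto
  also have "\<dots> \<le> card (P j) + card ((\<lambda>(p, g). g \<circ> tr p x) ` (S \<times> Q))" by (rule card_Un_le)
  also have "\<dots> \<le> card (P j) + card (S \<times> Q)"
    by (intro add_left_mono card_image_le finite_cartesian_product insert.hyps finQ)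
  also have "\<dots> \<le> 2 ^ card S * m ^ j + m * card Q"
    unfolding card_cartesian_product
    by (intro add_mono IH mult_right_mono) (use insert.prems insert.hyps in auto)
  also have "\<dots> \<le> 2 ^ card (insert x S) * m ^ j" using Q insert.hyps by (simp add: mult.commute)
  finally show ?case .
qed

text \<open>Choose the element with the least number of cycles.\<close>

lemma exists_few_orbs:
  assumes S: "finite S" "S \<noteq> {}" and A: "A \<subseteq> {f. f permutes S}" "A \<noteq> {}"
  obtains a where "a \<in> A" "card A \<le> 2 ^ card S * card S ^ (card S - card (orbs S a))"
proof -
  obtain a0 where "a0 \<in> A" using A(2) by blast
  then obtain a where a: "a \<in> A" "\<And>f. f \<in> A \<Longrightarrow> card (orbs S a) \<le> card (orbs S f)"
    using ex_has_least_nat[of "\<lambda>f. f \<in> A" a0 "\<lambda>f. card (orbs S f)"] by blast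
  have "A \<subseteq> {f. f permutes S \<and> card S \<le> card (orbs S f) + (card S - card (orbs S a))}"
  proof
    fix f assume f: "f \<in> A"
    then show "f \<in> {f. f permutes S \<and> card S \<le> card (orbs S f) + (card S - card (orbs S a))}"
      using a(2)[OF f] A(1) by auto
  qed
  then have "card A \<le> card {f. f permutes S \<and> card S \<le> card (orbs S f) + (card S - card (orbs S a))}"
    using finite_permutations[OF S(1)] by (intro card_mono) auto
  also have "\<dots> \<le> 2 ^ card S * card S ^ (card S - card (orbs S a))" 
    using S by (intro card_perms_many_orbs) (auto simp: card_gt_0_iff)
  finally show ?thesis using a(1) by (rule that[rotated])
qed

lemma power_self_le_fact_exp: "real n ^ n \<le> fact n * exp (real n)"
proof -
  have "(\<Sum>k\<in>{n}. real n ^ k /\<^sub>R fact k) \<le> exp (real n)"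
    unfolding exp_def by (rule sum_le_suminf) (use summable_exp_generic[of "real n"] in auto)
  then show ?thesis by (simp add: field_simps)
qed

text \<open>
  Up to factors that are exponential in n, the two sides are the powers of n with the exponents n and
  (1 + \<epsilon>) n.
\<close>

lemma eventually_fact_large:
  assumes "(\<epsilon>::real) > 0"
  shows "eventually (\<lambda>n. 4 ^ n * real n ^ (n + 9) < (fact n / 2) powr (1 + \<epsilon>)) sequentially"
proof -
  have "eventually (\<lambda>n::nat. real n * ln 4 + (real n + 9) * ln (real n) < (1 + \<epsilon>) * (real n * ln (real n) - real n - ln 2)) sequentially"
    using assms by real_asymp
  then show ?thesis using eventually_gt_at_top[of 0]
  proof eventually_elim
    case (elim n)
    then have n: "real n > 0" by simp
    have "ln (real n ^ n) \<le> ln (fact n * exp (real n))"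
      using power_self_le_fact_exp[of n] n by (subst ln_le_cancel_iff) auto
    then have f: "real n * ln (real n) - real n \<le> ln (fact n :: real)"
      using n by (simp add: ln_mult ln_realpow)
    have "ln (4 ^ n * real n ^ (n + 9)) = real n * ln 4 + (real n + 9) * ln (real n)"
      using n by (simp add: ln_mult ln_realpow algebra_simps)
    also have "\<dots> < (1 + \<epsilon>) * (real n * ln (real n) - real n - ln 2)" using elim by simp
    also have "\<dots> \<le> (1 + \<epsilon>) * ln (fact n / 2 :: real)"
      using f assms by (intro mult_left_mono) (auto simp: ln_div)
    also have "\<dots> = ln ((fact n / 2) powr (1 + \<epsilon>))" by (simp add: ln_powr)
    finally show ?case using n by (subst (asm) ln_less_cancel_iff) auto
  qed
qed

section \<open>Normal subsets of the alternating group\<close>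

text \<open>
  One element of the given cycle type in the product set is enough, since all of them are conjugate
  by even permutations and the product set is normal.
\<close>

lemma hook_subset_product:
  fixes n :: nat
  assumes n: "49 < n" and k: "k = (if even n then 3 else 2)"
    and A: "normal_subset A (alt_group n)" "a \<in> A" and B: "normal_subset B (alt_group n)" "b \<in> B"
    and few: "card (orbs {1..n} a) + card (orbs {1..n} b) + 10 \<le> n"
    and t: "t permutes {1..n}" "ctype {1..n} t = hook_type n k"
  shows "t \<in> A <#>\<^bsub>alt_group n\<^esub> B"
proof -
  let ?S = "{1..n}"
  have S: "finite ?S" "card ?S = n" by simp_all
  have k2: "2 \<le> k" using k by simp
  have perm: "x permutes ?S" "evenperm x" if "normal_subset X (alt_group n)" "x \<in> X" for x X
    using that by (auto simp: normal_subset_def alt_group_carrier)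
  have conj: "h \<circ> x \<circ> inv' h \<in> X"
    if X: "normal_subset X (alt_group n)" "x \<in> X" and h: "h permutes ?S" "evenperm h" for x X h
  proof -
    have hG: "h \<in> carrier (alt_group n)" using h by (simp add: alt_group_carrier)
    then have "h <#\<^bsub>alt_group n\<^esub> X #>\<^bsub>alt_group n\<^esub> inv\<^bsub>alt_group n\<^esub> h = X" using X by (simp add: normal_subset_def)
    moreover have "h \<otimes>\<^bsub>alt_group n\<^esub> x \<otimes>\<^bsub>alt_group n\<^esub> inv\<^bsub>alt_group n\<^esub> h \<in> h <#\<^bsub>alt_group n\<^esub> X #>\<^bsub>alt_group n\<^esub> inv\<^bsub>alt_group n\<^esub> h"
      using X(2) by (auto simp: l_coset_def r_coset_def)
    ultimately show ?thesis by (simp add: alt_group_mult alt_group_inv_equality[OF hG])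
  qed
  obtain h where h: "h permutes ?S" "evenperm h" "ctype ?S (a \<circ> (h \<circ> b \<circ> inv' h)) = hook_type n k"
    using even_conj_product_hook[OF S perm[OF A] perm[OF B] few n k] .
  let ?b = "h \<circ> b \<circ> inv' h"
  have "a \<circ> ?b permutes ?S" by (rule permutes_compose[OF permutes_conj[OF perm(1)[OF B] h(1)] perm(1)[OF A]])
  then obtain g where g: "g permutes ?S" "evenperm g" "g \<circ> (a \<circ> ?b) \<circ> inv' g = t"
    using conj_hook_even[OF S(1) _ h(3) t k2] by blast
  have "t = (g \<circ> a \<circ> inv' g) \<circ> (g \<circ> ?b \<circ> inv' g)"
    unfolding g(3)[symmetric] using permutes_inverses(2)[OF g(1)] by (simp add: fun_eq_iff)
  moreover have "g \<circ> a \<circ> inv' g \<in> A" "g \<circ> ?b \<circ> inv' g \<in> B"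
    using conj[OF A g(1,2)] conj[OF B(1) conj[OF B h(1,2)] g(1,2)] by auto
  ultimately show ?thesis unfolding set_mult_def alt_group_mult by blast
qed

lemma few_orbs_if_large:
  assumes n: "0 < n" and A: "A \<subseteq> carrier (alt_group n)" and B: "B \<subseteq> carrier (alt_group n)"
    and large: "4 ^ n * real n ^ (n + 9) < real (card A * card B)"
  obtains a b where "a \<in> A" "b \<in> B" "card (orbs {1..n} a) + card (orbs {1..n} b) + 10 \<le> n"
proof -
  let ?S = "{1..n}"
  have S: "finite ?S" "?S \<noteq> {}" "card ?S = n" using n by simp_all
  have "0 < 4 ^ n * real n ^ (n + 9)" using n by simp
  then have "real (card A * card B) \<noteq> 0" using large by linarith
  then have "A \<noteq> {}" "B \<noteq> {}" by auto
  note ne = this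
  have "A \<subseteq> {f. f permutes ?S}" "B \<subseteq> {f. f permutes ?S}" using A B by (auto simp: alt_group_carrier)
  note perms = this
  obtain a where a: "a \<in> A" "card A \<le> 2 ^ n * n ^ (n - card (orbs ?S a))"
    using exists_few_orbs[OF S(1,2) perms(1) ne(1)] unfolding S(3) .
  obtain b where b: "b \<in> B" "card B \<le> 2 ^ n * n ^ (n - card (orbs ?S b))"
    using exists_few_orbs[OF S(1,2) perms(2) ne(2)] unfolding S(3) .
  have "card (orbs ?S a) + card (orbs ?S b) + 10 \<le> n"
  proof (rule ccontr)
    assume "\<not> ?thesis"
    moreover have "card (orbs ?S f) \<le> n" for f using card_image_le[OF S(1), of "orbit f"] by (simp add: orbs_def)
    from this[of a] this[of b]
    have "n - card (orbs ?S a) + (n - card (orbs ?S b)) = 2 * n - (card (orbs ?S a) + card (orbs ?S b))" by simp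
    ultimately have le: "n - card (orbs ?S a) + (n - card (orbs ?S b)) \<le> n + 9" by linarith
    have four: "(4::nat) ^ n = 2 ^ n * 2 ^ n" by (simp flip: power_mult_distrib)
    have "card A * card B \<le> (2 ^ n * n ^ (n - card (orbs ?S a))) * (2 ^ n * n ^ (n - card (orbs ?S b)))"
      using a(2) b(2) by (rule mult_le_mono)
    also have "\<dots> = 4 ^ n * n ^ (n - card (orbs ?S a) + (n - card (orbs ?S b)))"
      unfolding four power_add by (simp only: mult_ac)
    also have "\<dots> \<le> 4 ^ n * n ^ (n + 9)" using le n by (intro mult_le_mono2 power_increasing) auto
    finally have "real (card A * card B) \<le> real (4 ^ n * n ^ (n + 9))" by (rule of_nat_mono)
    also have "real (4 ^ n * n ^ (n + 9)) = 4 ^ n * real n ^ (n + 9)" by (simp only: of_nat_mult of_nat_power of_nat_numeral)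
    finally have "real (card A * card B) \<le> 4 ^ n * real n ^ (n + 9)" .
    from leD[OF this] large show False by (rule notE)
  qed
  with a(1) b(1) show ?thesis by (rule that)
qed

theorem theorem1p1:
  fixes \<epsilon> :: real
  assumes "\<epsilon> > 0"
  shows "\<exists>N::nat. \<forall>n>N. \<forall>A B C D.
    normal_subset A (alt_group n) \<and> normal_subset B (alt_group n) \<and>
    normal_subset C (alt_group n) \<and> normal_subset D (alt_group n) \<and>
    real (card A * card B) \<ge> real (order (alt_group n)) powr (1 + \<epsilon>) \<and>
    real (card A * card C) \<ge> real (order (alt_group n)) powr (1 + \<epsilon>) \<and>
    real (card A * card D) \<ge> real (order (alt_group n)) powr (1 + \<epsilon>) \<and>
    real (card B * card C) \<ge> real (order (alt_group n)) powr (1 + \<epsilon>) \<and>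
    real (card B * card D) \<ge> real (order (alt_group n)) powr (1 + \<epsilon>) \<and>
    real (card C * card D) \<ge> real (order (alt_group n)) powr (1 + \<epsilon>)
    \<longrightarrow> A <#>\<^bsub>alt_group n\<^esub> B <#>\<^bsub>alt_group n\<^esub> C <#>\<^bsub>alt_group n\<^esub> D = carrier (alt_group n)"
proof -
  obtain N0 where N0: "\<And>n. n \<ge> N0 \<Longrightarrow> 4 ^ n * real n ^ (n + 9) < (fact n / 2) powr (1 + \<epsilon>)"
    using eventually_fact_large[OF assms] unfolding eventually_sequentially by blast
  show ?thesis
  proof (intro exI[of _ "max N0 49"] allI impI)
    fix n :: nat and A B C D :: "(nat \<Rightarrow> nat) set"
    let ?G = "alt_group n"
    assume n: "max N0 49 < n"
      and "normal_subset A ?G \<and> normal_subset B ?G \<and> normal_subset C ?G \<and> normal_subset D ?G \<and>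
    real (card A * card B) \<ge> real (order ?G) powr (1 + \<epsilon>) \<and>
    real (card A * card C) \<ge> real (order ?G) powr (1 + \<epsilon>) \<and>
    real (card A * card D) \<ge> real (order ?G) powr (1 + \<epsilon>) \<and>
    real (card B * card C) \<ge> real (order ?G) powr (1 + \<epsilon>) \<and>
    real (card B * card D) \<ge> real (order ?G) powr (1 + \<epsilon>) \<and>
    real (card C * card D) \<ge> real (order ?G) powr (1 + \<epsilon>)"
    then have nA: "normal_subset A ?G" and nB: "normal_subset B ?G" and nC: "normal_subset C ?G"
      and nD: "normal_subset D ?G" and AB: "real (order ?G) powr (1 + \<epsilon>) \<le> real (card A * card B)"
      and CD: "real (order ?G) powr (1 + \<epsilon>) \<le> real (card C * card D)" by blast+
    have card_n: "card {1..n} = n" by simp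
    have n49: "49 < n" "0 < n" and nN: "N0 \<le> n" using n by auto
    interpret G: group ?G by (rule alt_group_is_group)
    have sub: "A \<subseteq> carrier ?G" "B \<subseteq> carrier ?G" "C \<subseteq> carrier ?G" "D \<subseteq> carrier ?G"
      using nA nB nC nD by (auto simp: normal_subset_def)
    have "2 * card (carrier ?G) = fact n" by (rule alt_group_card_carrier) (use n49 in simp)
    then have "real (2 * card (carrier ?G)) = fact n" by simp
    then have ord: "real (order ?G) = fact n / 2" by (simp add: order_def)
    have big: "4 ^ n * real n ^ (n + 9) < real (order ?G) powr (1 + \<epsilon>)" unfolding ord by (rule N0[OF nN])
    define k where k: "k = (if even n then 3 else 2 :: nat)"
    obtain a b where ab: "a \<in> A" "b \<in> B" "card (orbs {1..n} a) + card (orbs {1..n} b) + 10 \<le> n"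
      using few_orbs_if_large[OF n49(2) sub(1,2) less_le_trans[OF big AB]] .
    obtain c d where cd: "c \<in> C" "d \<in> D" "card (orbs {1..n} c) + card (orbs {1..n} d) + 10 \<le> n"
      using few_orbs_if_large[OF n49(2) sub(3,4) less_le_trans[OF big CD]] .
    have mult: "x \<circ> y \<in> X <#>\<^bsub>?G\<^esub> Y" if "x \<in> X" "y \<in> Y" for x y X Y
      using that unfolding set_mult_def alt_group_mult by blast
    show "A <#>\<^bsub>?G\<^esub> B <#>\<^bsub>?G\<^esub> C <#>\<^bsub>?G\<^esub> D = carrier ?G"
    proof
      show "A <#>\<^bsub>?G\<^esub> B <#>\<^bsub>?G\<^esub> C <#>\<^bsub>?G\<^esub> D \<subseteq> carrier ?G"
        by (intro G.set_mult_closed sub)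
      show "carrier ?G \<subseteq> A <#>\<^bsub>?G\<^esub> B <#>\<^bsub>?G\<^esub> C <#>\<^bsub>?G\<^esub> D"
      proof
        fix g assume "g \<in> carrier ?G"
        then have g: "g permutes {1..n}" "evenperm g" by (simp_all add: alt_group_carrier)
        obtain t u where t: "t permutes {1..n}" "ctype {1..n} t = hook_type n k"
          and u: "u permutes {1..n}" "ctype {1..n} u = hook_type n k" and gtu: "g = t \<circ> u"
          using even_perm_product_of_hooks[OF finite_atLeastAtMost card_n g n49(1) k] .
        have "t \<in> A <#>\<^bsub>?G\<^esub> B" by (rule hook_subset_product[OF n49(1) k nA ab(1) nB ab(2,3) t])
        moreover have "u \<in> C <#>\<^bsub>?G\<^esub> D" by (rule hook_subset_product[OF n49(1) k nC cd(1) nD cd(2,3) u])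
        then obtain c' d' where cd': "c' \<in> C" "d' \<in> D" "u = c' \<circ> d'" unfolding set_mult_def alt_group_mult by blast
        ultimately have "t \<circ> c' \<circ> d' \<in> A <#>\<^bsub>?G\<^esub> B <#>\<^bsub>?G\<^esub> C <#>\<^bsub>?G\<^esub> D" by (intro mult)
        then show "g \<in> A <#>\<^bsub>?G\<^esub> B <#>\<^bsub>?G\<^esub> C <#>\<^bsub>?G\<^esub> D" using gtu cd'(3) by (simp add: o_assoc)
      qed
    qed
  qed
qed

end
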